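(* Let $\mathcal G$ be a game (of some rank $n$) that contains a finite attractor, and let $x\in\{0,1\}$. Then there exist memoryless strategies $f^x\in F^x_\emptyset(\mathcal G)$ of Player $x$ and $f^{1-x}\in F^{1-x}_\emptyset(\mathcal G)$ of Player $1-x$ and a partition $S=W\cup W'$, $W\cap W'=\emptyset$, such that $W\subseteq W^x(f^x,F^{1-x}_{finite}(\mathcal G))(\mathcal G,(x\text{-Parity})^{=1})$ and $W'\subseteq W^{1-x}(f^{1-x},F^{x}_{finite}(\mathcal G))(\mathcal G,((1-x)\text{-Parity})^{>0})$. In other words, stochastic parity games with almost-sure winning conditions on possibly infinite graphs with a finite attractor are memoryless determined when both players are restricted to finite-memory strategies.
   Context: A game of rank $n$ is a tuple $\mathcal G=(S,S^0,S^1,S^R,\to,P,\mathrm{Col})$: $S$ is a set of states partitioned into pairwise disjoint sets $S^0$ (states of Player 0), $S^1$ (states of Player 1) and $S^R$ (random states); $\to\subseteq S\times S$ is a transition relation in which every state has at least one and at most countably many successors; $P:S^R\times S\to[0,1]$ satisfies $P(s,s')>0\iff s\to s'$ and $\sum_{s'}P(s,s')=1$ for every $s\in S^R$; $\mathrm{Col}:S\to\{0,\dots,n\}$ is a coloring. A run is an infinite sequence $s_0s_1\cdots$ with $s_i\to s_{i+1}$ for all $i$; a path is a finite such sequence. For $x\in\{0,1\}$, a strategy of Player $x$ is a partial function $f$ from the set of paths ending in $S^x$ to $S$ with $s_n\to f(s_0\cdots s_n)$ whenever defined; it is total if defined on all such paths, and memoryless if $f(s_0\cdots s_n)$ depends only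 on $s_n$. A finite-memory strategy is a total strategy of the form $f(s_0\cdots s_n)=\tau(s_n,\mu(s_0\cdots s_{n-1},m_0))$ for a finite set $M$, $m_0\in M$, $\tau:S^x\times M\to S$ with $s\to\tau(s,m)$, and $\mu:S\times M\to M$ extended to paths by $\mu(\varepsilon,m)=m$, $\mu(s_0\cdots s_n,m)=\mu(s_n,\mu(s_0\cdots s_{n-1},m))$. $F^x_{all}(\mathcal G)$, $F^x_{finite}(\mathcal G)$, $F^x_\emptyset(\mathcal G)$ denote the sets of all, finite-memory, and memoryless strategies of Player $x$. A run is consistent with $f$ if $s_{i+1}=f(s_0\cdots s_i)$ whenever the latter is defined. For total strategies $f^0,f^1$ and a state $s$, $\mathcal P_{\mathcal G,s,f^0,f^1}$ is the induced probability measure on runs from $s$ (in states of $S^x$ the successor is chosen by Player $x$'s strategy, in $S^R$ randomly according to $P$); for partial strategies, $\mathcal P_{\mathcal G,s,f^0,f^1}(\varphi)\sim c$ means this holds for all total extensions. For a strategy $f^x$ of Player $x$, a set $F$ of strategies of Player $1-x$, a run property $\varphi$, $\sim\in\{=,>\}$ and $c\in[0,1]$: $W^x(f^x,F)(\mathcal G,\varphi^{\sim c})=\{s:\ \mathcal P_{\mathcal G,s,f^x,g}(\varphi)\sim c$ for every total $g\in F\}$. The condition $x$-Parity holds for a run iff the largest color occurring infinitely often along it is congruent to $x$ modulo 2. A set $A\subseteq S$ is an attractor if $\mathcal P_{\mathcal G,s,f^0,f^1}(\text{the run visits }A)=1$ for every state $s$ and all strategies $f^0,f^1$. *)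

theory Defs
  imports "HOL-Probability.Probability"
begin

text \<open>Games. The state set S is the universe of the state type 's.
  S0, S1, SR are the states of Player 0, Player 1 and the random states,
  E is the transition relation, Prob the probability function on random
  states, Col the colouring.\<close>

record 's game =
  S0 :: "'s set"
  S1 :: "'s set"
  SR :: "'s set"
  E :: "('s \<times> 's) set"
  Prob :: "'s \<Rightarrow> 's \<Rightarrow> real"
  Col :: "'s \<Rightarrow> nat"

definition is_game :: "'s game \<Rightarrow> nat \<Rightarrow> bool" where
  "is_game G n \<longleftrightarrow>
     S0 G \<union> S1 G \<union> SR G = UNIV \<and>
     S0 G \<inter> S1 G = {} \<and> S0 G \<inter> SR G = {} \<and> S1 G \<inter> SR G = {} \<and>
     (\<forall>s. \<exists>t. (s, t) \<in> E G) \<and>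
     (\<forall>s. countable {t. (s, t) \<in> E G}) \<and>
     (\<forall>s \<in> SR G. (\<forall>t. 0 \<le> Prob G s t \<and> Prob G s t \<le> 1 \<and>
                       (0 < Prob G s t \<longleftrightarrow> (s, t) \<in> E G)) \<and>
                  ((\<lambda>t. Prob G s t) has_sum 1) UNIV) \<and>
     (\<forall>s. Col G s \<le> n)"

definition player_states :: "'s game \<Rightarrow> nat \<Rightarrow> 's set" where
  "player_states G x = (if x = 0 then S0 G else S1 G)"

definition is_path :: "'s game \<Rightarrow> 's list \<Rightarrow> bool" where
  "is_path G p \<longleftrightarrow> p \<noteq> [] \<and> (\<forall>i. Suc i < length p \<longrightarrow> (p ! i, p ! Suc i) \<in> E G)"

text \<open>Strategies are partial functions (option-valued) on paths ending in
  a state of player x; the value None outside that set is a normalisation.\<close>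
definition strategy :: "'s game \<Rightarrow> nat \<Rightarrow> ('s list \<Rightarrow> 's option) \<Rightarrow> bool" where
  "strategy G x f \<longleftrightarrow>
     (\<forall>p. f p \<noteq> None \<longrightarrow> is_path G p \<and> last p \<in> player_states G x) \<and>
     (\<forall>p t. f p = Some t \<longrightarrow> (last p, t) \<in> E G)"

definition total_strategy :: "'s game \<Rightarrow> nat \<Rightarrow> ('s list \<Rightarrow> 's option) \<Rightarrow> bool" where
  "total_strategy G x f \<longleftrightarrow> strategy G x f \<and>
     (\<forall>p. is_path G p \<and> last p \<in> player_states G x \<longrightarrow> f p \<noteq> None)"

definition memoryless :: "'s game \<Rightarrow> nat \<Rightarrow> ('s list \<Rightarrow> 's option) \<Rightarrow> bool" where
  "memoryless G x f \<longleftrightarrow> strategy G x f \<and>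
     (\<forall>p q. is_path G p \<and> is_path G q \<and> last p \<in> player_states G x \<and> last p = last q
            \<longrightarrow> f p = f q)"

definition memoryless_strategies :: "'s game \<Rightarrow> nat \<Rightarrow> ('s list \<Rightarrow> 's option) set" where
  "memoryless_strategies G x = {f. memoryless G x f}"

definition mu_path :: "('s \<Rightarrow> nat \<Rightarrow> nat) \<Rightarrow> 's list \<Rightarrow> nat \<Rightarrow> nat" where
  "mu_path mu p m = foldl (\<lambda>m' s. mu s m') m p"

text \<open>Finite-memory strategies; the finite memory set is taken (w.l.o.g.,
  up to renaming) as a finite set of natural numbers.\<close>
definition finite_memory :: "'s game \<Rightarrow> nat \<Rightarrow> ('s list \<Rightarrow> 's option) \<Rightarrow> bool" where
  "finite_memory G x f \<longleftrightarrow> total_strategy G x f \<and>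
     (\<exists>(M::nat set) m0 tau mu. finite M \<and> m0 \<in> M \<and>
        (\<forall>s. \<forall>m \<in> M. mu s m \<in> M) \<and>
        (\<forall>s \<in> player_states G x. \<forall>m \<in> M. (s, tau s m) \<in> E G) \<and>
        (\<forall>p. is_path G p \<and> last p \<in> player_states G x \<longrightarrow>
              f p = Some (tau (last p) (mu_path mu (butlast p) m0))))"

definition finite_memory_strategies :: "'s game \<Rightarrow> nat \<Rightarrow> ('s list \<Rightarrow> 's option) set" where
  "finite_memory_strategies G x = {f. finite_memory G x f}"

definition extends :: "('s list \<Rightarrow> 's option) \<Rightarrow> ('s list \<Rightarrow> 's option) \<Rightarrow> bool" where
  "extends g f \<longleftrightarrow> (\<forall>p. f p \<noteq> None \<longrightarrow> g p = f p)"

definition step_prob :: "'s game \<Rightarrow> ('s list \<Rightarrow> 's option) \<Rightarrow> ('s list \<Rightarrow> 's option)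
    \<Rightarrow> 's list \<Rightarrow> 's \<Rightarrow> real" where
  "step_prob G f0 f1 q t =
     (if last q \<in> S0 G then (if f0 q = Some t then 1 else 0)
      else if last q \<in> S1 G then (if f1 q = Some t then 1 else 0)
      else Prob G (last q) t)"

definition cyl_prob :: "'s game \<Rightarrow> 's \<Rightarrow> ('s list \<Rightarrow> 's option) \<Rightarrow> ('s list \<Rightarrow> 's option)
    \<Rightarrow> 's list \<Rightarrow> real" where
  "cyl_prob G s f0 f1 p =
     (if p = [] then 1 else if hd p \<noteq> s then 0
      else (\<Prod>i < length p - 1. step_prob G f0 f1 (take (Suc i) p) (p ! Suc i)))"

definition cyl :: "'s list \<Rightarrow> 's stream set" where
  "cyl p = {\<omega>. stake (length p) \<omega> = p}"

definition run_measure :: "'s game \<Rightarrow> 's \<Rightarrow> ('s list \<Rightarrow> 's option) \<Rightarrow> ('s list \<Rightarrow> 's option)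
    \<Rightarrow> 's stream measure" where
  "run_measure G s f0 f1 = (THE M. sets M = sets (stream_space (count_space UNIV)) \<and>
      prob_space M \<and> (\<forall>p. emeasure M (cyl p) = ennreal (cyl_prob G s f0 f1 p)))"

definition parity :: "'s game \<Rightarrow> nat \<Rightarrow> 's stream set" where
  "parity G x = {\<omega>. \<exists>c. infinite {i. Col G (\<omega> !! i) = c} \<and>
      (\<forall>d. infinite {i. Col G (\<omega> !! i) = d} \<longrightarrow> d \<le> c) \<and> c mod 2 = x mod 2}"

text \<open>W^x(f, F)(G, phi^{Q}) where Q expresses "~ c" (e.g. "= 1", "> 0").
  The strategy f of player x may be partial: the condition is required for
  all total extensions.\<close>
definition winning_set :: "'s game \<Rightarrow> nat \<Rightarrow> ('s list \<Rightarrow> 's option)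
    \<Rightarrow> ('s list \<Rightarrow> 's option) set \<Rightarrow> 's stream set \<Rightarrow> (real \<Rightarrow> bool) \<Rightarrow> 's set" where
  "winning_set G x f F phi Q = {s. \<forall>g \<in> F. total_strategy G (1 - x) g \<longrightarrow>
      (\<forall>h. total_strategy G x h \<and> extends h f \<longrightarrow>
         Q (measure (if x = 0 then run_measure G s h g else run_measure G s g h) phi))}"

definition attractor :: "'s game \<Rightarrow> 's set \<Rightarrow> bool" where
  "attractor G A \<longleftrightarrow> (\<forall>s f0 f1. total_strategy G 0 f0 \<and> total_strategy G 1 f1 \<longrightarrow>
      measure (run_measure G s f0 f1) {\<omega>. \<exists>i. \<omega> !! i \<in> A} = 1)"

end

theory Submission
  imports Defs
begin

text \<open>If one player plays positionally and the other with finite memory, the play is a Markov chain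
  on pairs of a state and a memory value. The finite attractor makes almost every run enter a
  recurrent class and visit each of its nodes infinitely often, so z-Parity has positive probability
  iff a recurrent class with largest colour congruent to z is reachable, and (1-z)-Parity is almost
  sure iff none is.

  Let V be the union of all sets on which z has a positional strategy that makes such a class
  reachable; V has such a strategy itself. By induction on the number of colours, 1-z has a
  positional strategy preventing it on the complement G' of V, a trap for z. If the largest colour N
  belongs to 1-z, then 1-z attracts to N inside G'; on the rest, which has fewer colours, z has an
  empty region by maximality of V. If N belongs to z, the first case with the players exchanged
  applies to G'; by maximality of V, 1-z wins with positive probability everywhere in G', hence
  almost surely.\<close>

text \<open>On an infinite graph a set that is reachable from every node may still be missed with
  positive probability, because the play can drift away. A finite attractor removes this, since only
  the worst of finitely many chances counts. Finite memory keeps the attractor of the product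
  finite, as \<open>A \<times> M\<close>; with infinite memory a play need not have any recurrent
  class. The determinacy argument itself is combinatorial. It sees a play as the graph
  \<open>step_rel\<close>; probability only shows that \<open>A\<close> is always reachable and
  turns \<open>parity_possible\<close> back into probabilities. Regions are not built by transfinite
  iteration of one-step attractors. Each is the union of all that some positional strategy secures,
  so closure properties follow from maximality once a single strategy secures the union. That needs
  properties inherited backwards along steps. Positive probability has this inheritance and
  almost-sure winning lacks it, so regions belong to the positive-probability player and the
  almost-sure player gets the complement. Since \<open>run_measure\<close> is a definite
  description, the chain must also be shown to be its only solution.\<close>

section \<open>Markov chains with a finite attractor\<close>

text \<open>A stream of functions holds independent successor choices for all nodes at all times. Choices
  outside C are ignored, so that only countably many nodes are visited and the walk is measurable
  also when the node type is uncountable.\<close>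
primcorec walk :: "'t set \<Rightarrow> 't \<Rightarrow> ('t \<Rightarrow> 't) stream \<Rightarrow> 't stream" where
  "shd (walk C v \<omega>) = v"
| "stl (walk C v \<omega>) = walk C (if shd \<omega> v \<in> C then shd \<omega> v else v) (stl \<omega>)"

definition chain_measure :: "('t \<Rightarrow> 't pmf) \<Rightarrow> 't set \<Rightarrow> 't \<Rightarrow> 't stream measure" where
  "chain_measure K C v = distr (stream_space (PiM UNIV (\<lambda>i. measure_pmf (K i))))
     (stream_space (count_space UNIV)) (walk C v)"

definition recurrent :: "('t \<times> 't) set \<Rightarrow> 't \<Rightarrow> bool" where
  "recurrent R t \<longleftrightarrow> (\<forall>u. (t, u) \<in> R\<^sup>* \<longrightarrow> (u, t) \<in> R\<^sup>*)"

definition top_colour :: "('t \<times> 't) set \<Rightarrow> ('t \<Rightarrow> nat) \<Rightarrow> 't \<Rightarrow> nat \<Rightarrow> bool" where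
  "top_colour R col t c \<longleftrightarrow> (\<exists>u. (t, u) \<in> R\<^sup>* \<and> col u = c) \<and> (\<forall>u. (t, u) \<in> R\<^sup>* \<longrightarrow> col u \<le> c)"

text \<open>The set \<open>parity\<close> restated for a colouring of arbitrary nodes, so that it
  applies to pairs of a state and a memory value.\<close>

definition stream_parity :: "('t \<Rightarrow> nat) \<Rightarrow> nat \<Rightarrow> 't stream \<Rightarrow> bool" where
  "stream_parity col z \<omega> \<longleftrightarrow> (\<exists>c. infinite {i. col (\<omega> !! i) = c} \<and>
     (\<forall>d. infinite {i. col (\<omega> !! i) = d} \<longrightarrow> d \<le> c) \<and> c mod 2 = z mod 2)"

text \<open>If t reaches as few elements of F as possible, then every element of F reached from t is
  recurrent.\<close>
lemma reaches_recurrent: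
  assumes F: "finite F" "\<And>w. (v, w) \<in> R\<^sup>* \<Longrightarrow> \<exists>a\<in>F. (w, a) \<in> R\<^sup>*"
  shows "\<exists>t. (v, t) \<in> R\<^sup>* \<and> recurrent R t"
proof -
  define reached where "reached = (\<lambda>w. F \<inter> {a. (w, a) \<in> R\<^sup>*})"
  obtain t where t: "(v, t) \<in> R\<^sup>*" and
    min: "\<And>w. (v, w) \<in> R\<^sup>* \<Longrightarrow> card (reached t) \<le> card (reached w)"
    using ex_has_least_nat[of "\<lambda>w. (v, w) \<in> R\<^sup>*" v "\<lambda>w. card (reached w)"] by auto
  obtain a where a: "a \<in> F" "(t, a) \<in> R\<^sup>*" using F(2)[OF t] by auto
  have "(u, a) \<in> R\<^sup>*" if "(t, u) \<in> R\<^sup>*" for u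
  proof -
    have sub: "reached u \<subseteq> reached t" unfolding reached_def using that by (auto intro: rtrancl_trans)
    have "card (reached t) \<le> card (reached u)" using min[of u] t that by (auto intro: rtrancl_trans)
    then have "reached u = reached t"
      using sub F(1) by (intro card_subset_eq) (auto simp: reached_def intro: antisym card_mono)
    then show ?thesis using a unfolding reached_def by blast
  qed
  then have "recurrent R a" unfolding recurrent_def using a(2) by (meson rtrancl_trans)
  then show ?thesis using t a(2) by (meson rtrancl_trans)
qed

text \<open>Prefix independence. It makes the probability that parity fails a harmonic function of
  the start node.\<close>

lemma stream_parity_Stream: "stream_parity col z (v ## \<omega>) = stream_parity col z \<omega>"
proof -
  have "finite {i. col ((v ## \<omega>) !! i) = c} \<longleftrightarrow> finite {i. col (\<omega> !! i) = c}" for c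
  proof -
    have "{i. col ((v ## \<omega>) !! i) = c} \<subseteq> insert 0 (Suc ` {i. col (\<omega> !! i) = c})"
    proof
      fix i assume "i \<in> {i. col ((v ## \<omega>) !! i) = c}"
      then show "i \<in> insert 0 (Suc ` {i. col (\<omega> !! i) = c})" by (cases i) auto
    qed
    moreover have "Suc ` {i. col (\<omega> !! i) = c} \<subseteq> {i. col ((v ## \<omega>) !! i) = c}" by auto
    ultimately show ?thesis
      by (metis finite_imageD finite_imageI finite_insert finite_subset inj_Suc)
  qed
  then show ?thesis by (simp add: stream_parity_def del: snth.simps)
qed

lemma pred_snth: "Measurable.pred (stream_space (count_space UNIV)) (\<lambda>\<omega>. P (\<omega> !! i))"
  by (rule measurable_compose[OF measurable_snth]) simp

lemma pred_stream_parity [measurable]: "Measurable.pred (stream_space (count_space UNIV)) (stream_parity col z)"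
proof -
  have [measurable]: "Measurable.pred (stream_space (count_space UNIV)) (\<lambda>\<omega>. col (\<omega> !! i) = c)" for i c
    using pred_snth[of "\<lambda>w. col w = c"] .
  show ?thesis
    unfolding stream_parity_def[abs_def] infinite_nat_iff_unbounded_le mem_Collect_eq by measurable
qed

definition chain_rel :: "('t \<Rightarrow> 't pmf) \<Rightarrow> ('t \<times> 't) set" where
  "chain_rel K = {(v, w). w \<in> set_pmf (K v)}"

locale markov_chain =
  fixes K :: "'t \<Rightarrow> 't pmf" and C :: "'t set"
  assumes countable_C: "countable C"
    and closed_C: "v \<in> C \<Longrightarrow> set_pmf (K v) \<subseteq> C"
begin

abbreviation "T \<equiv> chain_measure K C"
abbreviation "PK \<equiv> PiM UNIV (\<lambda>i. measure_pmf (K i))"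
abbreviation "SS \<equiv> (stream_space (count_space UNIV) :: 't stream measure)"

lemma prob_space_PK: "prob_space PK"
  by (intro prob_space_PiM prob_space_measure_pmf)

lemma measurable_walk:
  assumes "v \<in> C" shows "walk C v \<in> measurable (stream_space PK) SS"
proof (rule measurable_stream_space2)
  fix n show "(\<lambda>\<omega>. walk C v \<omega> !! n) \<in> measurable (stream_space PK) (count_space UNIV)"
    using assms
  proof (induction n arbitrary: v)
    case 0 then show ?case by simp
  next
    case (Suc n)
    define next_of where "next_of = (\<lambda>\<omega> :: ('t \<Rightarrow> 't) stream. if shd \<omega> v \<in> C then shd \<omega> v else v)"
    have c: "(\<lambda>x :: 't \<Rightarrow> 't. x v) \<in> measurable PK (count_space UNIV)"
      using measurable_component_singleton[of v UNIV "\<lambda>i. measure_pmf (K i)"] by simp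
    have c': "(\<lambda>\<omega>. shd \<omega> v) \<in> measurable (stream_space PK) (count_space UNIV)"
      using measurable_compose[OF measurable_shd c] .
    have "next_of \<in> measurable (stream_space PK) (count_space C)"
      unfolding next_of_def
      by (rule measurable_compose[OF c', of "\<lambda>w. if w \<in> C then w else v"]) (use Suc.prems in auto)
    \<comment> \<open>\<open>next_of\<close> has values in the countable set \<open>C\<close>, so
      measurability for each fixed start node, which the induction hypothesis gives,
      suffices.\<close>
    then have "(\<lambda>\<omega>. walk C (next_of \<omega>) (stl \<omega>) !! n) \<in> measurable (stream_space PK) (count_space UNIV)"
      by (intro measurable_compose_countable'[where g = next_of and I = C
            and f = "\<lambda>w \<omega>. walk C w (stl \<omega>) !! n"]
          countable_C measurable_compose[OF measurable_stl Suc.IH])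
    then show ?case by (simp add: next_of_def)
  qed
qed

lemma prob_space_T: "v \<in> C \<Longrightarrow> prob_space (T v)"
  unfolding chain_measure_def
  by (intro prob_space.prob_space_distr prob_space.prob_space_stream_space prob_space_PK measurable_walk)

lemma sets_T [simp, measurable_cong]: "sets (T v) = sets SS"
  by (simp add: chain_measure_def)

lemma space_T [simp]: "space (T v) = UNIV"
  by (simp add: chain_measure_def space_stream_space)

text \<open>The Markov property at time one: the head of the choice stream is independent of its
  tail, only its coordinate at \<open>v\<close> is read, and that coordinate has law
  \<open>K v\<close>.\<close>

lemma emeasure_T:
  assumes v: "v \<in> C" and Q [measurable]: "Measurable.pred SS Q"
  shows "emeasure (T v) {\<omega>. Q \<omega>} = (\<integral>\<^sup>+ w. emeasure (T w) {\<omega>. Q (v ## \<omega>)} \<partial>K v)"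
proof -
  interpret PK: prob_space PK by (rule prob_space_PK)
  note [measurable] = measurable_walk[OF v]
  have [simp]: "space (stream_space PK) = UNIV"
    by (simp add: space_stream_space space_PiM)
  have *: "emeasure (T w) {\<omega>. P \<omega>} = emeasure (stream_space PK) {\<omega>. P (walk C w \<omega>)}"
    if "w \<in> C" "Measurable.pred SS P" for w P
  proof -
    have [measurable]: "{\<omega>. P \<omega>} \<in> sets SS"
      using that(2) by (simp add: pred_def space_stream_space)
    note [measurable] = measurable_walk[OF that(1)]
    show ?thesis
      unfolding chain_measure_def by (subst emeasure_distr) (auto simp: vimage_def)
  qed
  have walk_Stream: "walk C v (x ## \<omega>) = v ## walk C (if x v \<in> C then x v else v) \<omega>" for x \<omega>
    by (rule stream.expand) simp
  have c: "(\<lambda>x :: 't \<Rightarrow> 't. x v) \<in> measurable PK (K v)"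
    by (rule measurable_component_singleton) simp
  have m: "Measurable.pred (stream_space PK) (\<lambda>\<omega>. Q (walk C v \<omega>))" by measurable
  have "emeasure (T v) {\<omega>. Q \<omega>} = emeasure (stream_space PK) {\<omega>. Q (walk C v \<omega>)}"
    by (rule *[OF v Q])
  also have "\<dots> = (\<integral>\<^sup>+ x. emeasure (stream_space PK) {\<omega>. Q (walk C v (x ## \<omega>))} \<partial>PK)"
    using m by (subst PK.emeasure_stream_space) (auto simp: pred_def)
  also have "\<dots> = (\<integral>\<^sup>+ x. emeasure (T (if x v \<in> C then x v else v)) {\<omega>. Q (v ## \<omega>)} \<partial>PK)"
    unfolding walk_Stream by (intro nn_integral_cong, subst *) (use v in auto)
  also have "\<dots> = (\<integral>\<^sup>+ w. emeasure (T (if w \<in> C then w else v)) {\<omega>. Q (v ## \<omega>)} \<partial>distr PK (K v) (\<lambda>x. x v))"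
    by (subst nn_integral_distr[OF c]) auto
  also have "distr PK (K v) (\<lambda>x. x v) = measure_pmf (K v)"
    using distr_PiM_component[of UNIV "\<lambda>i. measure_pmf (K i)" v] by (simp add: prob_space_measure_pmf)
  \<comment> \<open>Since \<open>C\<close> is closed, the fallback value \<open>v\<close> is used
    with probability 0.\<close>
  also have "(\<integral>\<^sup>+ w. emeasure (T (if w \<in> C then w else v)) {\<omega>. Q (v ## \<omega>)} \<partial>K v)
      = (\<integral>\<^sup>+ w. emeasure (T w) {\<omega>. Q (v ## \<omega>)} \<partial>K v)"
    using closed_C[OF v] by (intro nn_integral_cong_AE) (auto simp: AE_measure_pmf_iff)
  finally show ?thesis .
qed

lemma AE_T:
  assumes v: "v \<in> C" and Q [measurable]: "Measurable.pred SS Q"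
  shows "(AE \<omega> in T v. Q \<omega>) \<longleftrightarrow> (\<forall>w \<in> set_pmf (K v). AE \<omega> in T w. Q (v ## \<omega>))"
proof -
  have *: "(AE \<omega> in T w. P \<omega>) \<longleftrightarrow> emeasure (T w) {\<omega>. \<not> P \<omega>} = 0"
    if [measurable]: "Measurable.pred SS P" for w P
  proof -
    have "{\<omega>. \<not> P \<omega>} \<in> sets SS"
      using pred_intros_logic(2)[OF that] by (simp add: pred_def space_stream_space)
    then show ?thesis by (subst AE_iff_measurable[OF _ refl]) auto
  qed
  have "(AE \<omega> in T v. Q \<omega>) \<longleftrightarrow> (\<integral>\<^sup>+ w. emeasure (T w) {\<omega>. \<not> Q (v ## \<omega>)} \<partial>K v) = 0"
    by (simp add: * emeasure_T[OF v])
  also have "\<dots> \<longleftrightarrow> (\<forall>w \<in> set_pmf (K v). emeasure (T w) {\<omega>. \<not> Q (v ## \<omega>)} = 0)"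
    by (subst nn_integral_0_iff_AE) (auto simp: AE_measure_pmf_iff)
  also have "\<dots> \<longleftrightarrow> (\<forall>w \<in> set_pmf (K v). AE \<omega> in T w. Q (v ## \<omega>))"
    by (subst *) auto
  finally show ?thesis .
qed

lemma reach_C: "(v, w) \<in> (chain_rel K)\<^sup>* \<Longrightarrow> v \<in> C \<Longrightarrow> w \<in> C"
  by (induction rule: rtrancl_induct) (use closed_C in \<open>auto simp: chain_rel_def\<close>)

lemma AE_reach:
  assumes "v \<in> C"
  shows "AE \<omega> in T v. \<forall>i. (v, \<omega> !! i) \<in> (chain_rel K)\<^sup>*"
proof -
  have "AE \<omega> in T v. (v, \<omega> !! i) \<in> (chain_rel K)\<^sup>*" for i
    using assms
  proof (induction i arbitrary: v)
    case 0
    have "AE \<omega> in T v. shd \<omega> = v"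
      using 0 by (subst AE_T) auto
    then show ?case by (rule eventually_mono) simp
  next
    case (Suc i)
    have "AE \<omega> in T w. (v, \<omega> !! i) \<in> (chain_rel K)\<^sup>*" if "w \<in> set_pmf (K v)" for w
    proof -
      have "(v, w) \<in> chain_rel K" using that by (simp add: chain_rel_def)
      moreover have "w \<in> C" using that closed_C Suc.prems by auto
      ultimately show ?thesis
        by (intro eventually_mono[OF Suc.IH[of w]]) (auto intro: converse_rtrancl_into_rtrancl)
    qed
    then show ?case
      by (subst AE_T[OF Suc.prems pred_snth[of "\<lambda>w. (v, w) \<in> (chain_rel K)\<^sup>*" "Suc i"]]) simp
  qed
  then show ?thesis by (simp add: AE_all_countable)
qed

section \<open>Avoidance probabilities and almost sure visits\<close>

definition avoid_upto :: "'t set \<Rightarrow> nat \<Rightarrow> 't \<Rightarrow> ennreal" where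
  "avoid_upto U N v = emeasure (T v) {\<omega>. \<forall>i<N. \<omega> !! i \<notin> U}"

definition avoid :: "'t set \<Rightarrow> 't \<Rightarrow> ennreal" where
  "avoid U v = emeasure (T v) {\<omega>. \<forall>i. \<omega> !! i \<notin> U}"

lemma pred_avoid [measurable]:
  "Measurable.pred SS (\<lambda>\<omega>. \<forall>i. \<omega> !! i \<notin> U)" "Measurable.pred SS (\<lambda>\<omega>. \<forall>i<N. \<omega> !! i \<notin> U)"
proof -
  have [measurable]: "Measurable.pred (count_space UNIV) (\<lambda>x :: 't. x \<notin> U)" by simp
  show "Measurable.pred SS (\<lambda>\<omega>. \<forall>i. \<omega> !! i \<notin> U)" by measurable
  show "Measurable.pred SS (\<lambda>\<omega>. \<forall>i<N. \<omega> !! i \<notin> U)" by measurable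
qed

lemma all_snth_Stream: "(\<forall>i. P ((v ## \<omega>) !! i)) \<longleftrightarrow> P v \<and> (\<forall>i. P (\<omega> !! i))"
  by (metis snth.simps stream.sel not0_implies_Suc)

lemma all_less_snth_Stream:
  "(\<forall>i<Suc N. P ((v ## \<omega>) !! i)) \<longleftrightarrow> P v \<and> (\<forall>i<N. P (\<omega> !! i))"
  by (auto simp: less_Suc_eq_0_disj)

lemma avoid_step: "v \<in> C \<Longrightarrow> avoid U v = (if v \<in> U then 0 else \<integral>\<^sup>+ w. avoid U w \<partial>K v)"
  unfolding avoid_def by (subst emeasure_T) (simp_all add: all_snth_Stream[of "\<lambda>x. x \<notin> U"] del: snth.simps)

lemma avoid_upto_step:
  "v \<in> C \<Longrightarrow> avoid_upto U (Suc N) v = (if v \<in> U then 0 else \<integral>\<^sup>+ w. avoid_upto U N w \<partial>K v)"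
  unfolding avoid_upto_def
  by (subst emeasure_T[OF _ pred_avoid(2)]) (simp_all only: all_less_snth_Stream[of _ "\<lambda>x. x \<notin> U"], simp)

lemma avoid_upto_0: "v \<in> C \<Longrightarrow> avoid_upto U 0 v = 1"
  unfolding avoid_upto_def using prob_space.emeasure_space_1[OF prob_space_T] by simp

lemma avoid_le_1: "v \<in> C \<Longrightarrow> avoid U v \<le> 1"
  unfolding avoid_def using prob_space.measure_le_1[OF prob_space_T] by blast

lemma avoid_upto_LIMSEQ:
  assumes "v \<in> C" shows "(\<lambda>N. avoid_upto U N v) \<longlonglongrightarrow> avoid U v"
proof -
  interpret prob_space "T v" using prob_space_T assms .
  have m: "{\<omega>. \<forall>i<N. \<omega> !! i \<notin> U} \<in> sets SS" for N
    using pred_avoid(2) by (simp add: pred_def space_stream_space)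
  have "(\<lambda>N. emeasure (T v) {\<omega>. \<forall>i<N. \<omega> !! i \<notin> U}) \<longlonglongrightarrow> emeasure (T v) (\<Inter>N. {\<omega>. \<forall>i<N. \<omega> !! i \<notin> U})"
    by (rule Lim_emeasure_decseq) (use m in \<open>auto simp: decseq_def\<close>)
  also have "(\<Inter>N. {\<omega>. \<forall>i<N. \<omega> !! i \<notin> U}) = {\<omega>. \<forall>i. \<omega> !! i \<notin> U}" by auto
  finally show ?thesis by (simp add: avoid_def avoid_upto_def)
qed

lemma AE_hit_iff: "(AE \<omega> in T v. \<exists>i. \<omega> !! i \<in> U) \<longleftrightarrow> avoid U v = 0"
  unfolding avoid_def
  by (subst AE_iff_measurable[OF _ refl])
     (use pred_avoid(1)[of U] in \<open>auto simp: pred_def space_stream_space\<close>)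

text \<open>Induction backwards along the path. If \<open>avoid U v\<close> were 1, it would be an
  average of values at most 1, so every successor would have value 1 too.\<close>

lemma avoid_lt_1:
  assumes "(v, u) \<in> (chain_rel K)\<^sup>*" "u \<in> U" "v \<in> C"
  shows "avoid U v < 1"
  using assms
proof (induction rule: converse_rtrancl_induct)
  case base
  then show ?case by (simp add: avoid_step)
next
  case (step v w)
  have w: "w \<in> set_pmf (K v)" using step by (simp add: chain_rel_def)
  have sub: "set_pmf (K v) \<subseteq> C" using closed_C step by auto
  show ?case
  proof (rule ccontr)
    assume "\<not> avoid U v < 1"
    then have 1: "avoid U v = 1" using avoid_le_1[OF step.prems(2), of U] by simp
    then have "v \<notin> U" using avoid_step[OF step.prems(2), of U] by auto
    then have int: "(\<integral>\<^sup>+ w. avoid U w \<partial>K v) = 1" using avoid_step[OF step.prems(2), of U] 1 by simp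
    have "(\<integral>\<^sup>+ w. 1 - avoid U w \<partial>K v) = (\<integral>\<^sup>+ w. 1 \<partial>K v) - (\<integral>\<^sup>+ w. avoid U w \<partial>K v)"
      using sub avoid_le_1 int
      by (intro nn_integral_diff) (auto simp: AE_measure_pmf_iff)
    also have "\<dots> = 0" using int by simp
    finally have "\<forall>w\<in>set_pmf (K v). 1 - avoid U w = 0"
      by (subst (asm) nn_integral_0_iff_AE) (auto simp: AE_measure_pmf_iff)
    then have "1 - avoid U w = 0" using w by blast
    moreover have "avoid U w < 1" using step w sub by auto
    then have "0 < 1 - avoid U w" by (simp add: diff_gt_0_iff_gt_ennreal)
    ultimately show False by simp
  qed
qed

text \<open>The worst chance c < 1 of missing U from the finite set F bounds the chance of missing U
  from every node. For the supremum d of these chances, restarting after N steps gives d \<le> d * d.\<close>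
lemma finite_attractor_AE_hit:
  assumes D: "D \<subseteq> C" "\<And>v. v \<in> D \<Longrightarrow> set_pmf (K v) \<subseteq> D"
    and F: "finite F" "\<And>v. v \<in> D \<Longrightarrow> AE \<omega> in T v. \<exists>i. \<omega> !! i \<in> F"
    and U: "\<And>v. v \<in> D \<inter> F \<Longrightarrow> \<exists>u\<in>U. (v, u) \<in> (chain_rel K)\<^sup>*"
    and v: "v \<in> D"
  shows "AE \<omega> in T v. \<exists>i. \<omega> !! i \<in> U"
proof -
  define c where "c = (SUP v\<in>D \<inter> F. avoid U v)"
  have c1: "c < 1"
  proof (cases "D \<inter> F = {}")
    case False
    have "avoid U v < 1" if "v \<in> D \<inter> F" for v
      using U[OF that] avoid_lt_1 that D(1) by blast
    then show ?thesis
      unfolding c_def using F(1) False by (subst finite_Sup_less_iff) auto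
  qed (simp add: c_def bot_ennreal)
  \<comment> \<open>Stop the walk on entering \<open>F\<close>: from there \<open>U\<close> is
    missed with probability at most \<open>c\<close>, and the chance of not yet having entered
    \<open>F\<close> vanishes as \<open>N\<close> grows.\<close>
  have le: "avoid U v \<le> c + avoid_upto F N v" if "v \<in> D" for N v
    using that
  proof (induction N arbitrary: v)
    case 0
    have "avoid U v \<le> 1" "avoid_upto F 0 v = 1" using 0 D avoid_le_1 avoid_upto_0 by auto
    then show ?case by (metis add_increasing zero_le)
  next
    case (Suc N)
    have vC: "v \<in> C" using Suc D by auto
    consider "v \<in> F" | "v \<in> U" | "v \<notin> F" "v \<notin> U" by blast
    then show ?case
    proof cases
      case 1
      then have "avoid U v \<le> c" unfolding c_def using Suc.prems by (intro SUP_upper) auto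
      then show ?thesis by (simp add: add_increasing2)
    next
      case 2 then show ?thesis by (simp add: avoid_step[OF vC])
    next
      case 3
      have "avoid U v = (\<integral>\<^sup>+ w. avoid U w \<partial>K v)" using 3 by (simp add: avoid_step[OF vC])
      also have "\<dots> \<le> (\<integral>\<^sup>+ w. c + avoid_upto F N w \<partial>K v)"
        using Suc.IH D(2)[OF Suc.prems] by (intro nn_integral_mono_AE) (auto simp: AE_measure_pmf_iff)
      also have "\<dots> = c + avoid_upto F (Suc N) v"
        using 3 by (subst nn_integral_add)
          (auto simp: avoid_upto_step[OF vC] measure_pmf.emeasure_space_1[simplified])
      finally show ?thesis .
    qed
  qed
  have le_c: "avoid U v \<le> c" if "v \<in> D" for v
  proof -
    have "avoid F v = 0" using F(2)[OF that] by (simp add: AE_hit_iff)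
    then have "(\<lambda>N. c + avoid_upto F N v) \<longlonglongrightarrow> c + 0"
      using avoid_upto_LIMSEQ[of v F] that D(1) by (intro tendsto_add tendsto_const) auto
    then show ?thesis
      using LIMSEQ_le_const[of "\<lambda>N. c + avoid_upto F N v" "c + 0" "avoid U v"] le[OF that] by auto
  qed
  define d where "d = (SUP v\<in>D. avoid U v)"
  have d: "avoid U v \<le> d" if "v \<in> D" for v unfolding d_def using that by (rule SUP_upper)
  have dc: "d \<le> c" unfolding d_def by (intro SUP_least le_c)
  have mult: "avoid U v \<le> d * avoid_upto U N v" if "v \<in> D" for N v
    using that
  proof (induction N arbitrary: v)
    case 0 then show ?case using d D(1) by (auto simp: avoid_upto_0)
  next
    case (Suc N)
    have vC: "v \<in> C" using Suc D by auto
    show ?case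
    proof (cases "v \<in> U")
      case False
      have "avoid U v = (\<integral>\<^sup>+ w. avoid U w \<partial>K v)" using False by (simp add: avoid_step[OF vC])
      also have "\<dots> \<le> (\<integral>\<^sup>+ w. d * avoid_upto U N w \<partial>K v)"
        using Suc.IH D(2)[OF Suc.prems] by (intro nn_integral_mono_AE) (auto simp: AE_measure_pmf_iff)
      also have "\<dots> = d * avoid_upto U (Suc N) v"
        using False by (subst nn_integral_cmult) (auto simp: avoid_upto_step[OF vC])
      finally show ?thesis .
    qed (simp add: avoid_step[OF vC])
  qed
  have "avoid U v \<le> d * d" if "v \<in> D" for v
  proof -
    \<comment> \<open>\<open>d\<close> is finite because \<open>d \<le> c < 1\<close>; in
      \<open>ennreal\<close> this is needed to move the constant factor through the limit.\<close>
    have "(\<lambda>N. d * avoid_upto U N v) \<longlonglongrightarrow> d * avoid U v"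
      using c1 dc that D(1) by (intro ennreal_tendsto_cmult avoid_upto_LIMSEQ) (auto simp: less_top[symmetric] top_unique)
    then have "avoid U v \<le> d * avoid U v"
      using mult[OF that] by (intro LIMSEQ_le_const) auto
    also have "\<dots> \<le> d * d" using d[OF that] by (rule mult_left_mono) simp
    finally show ?thesis .
  qed
  then have dd: "d \<le> d * d" unfolding d_def[symmetric] by (subst d_def) (rule SUP_least)
  have "d = 0"
  proof (rule ccontr)
    assume "d \<noteq> 0"
    have "d < 1" using c1 dc by auto
    then obtain r where r: "d = ennreal r" "0 \<le> r" "r < 1"
      by (cases d) (auto simp: ennreal_less_one_iff)
    then have "r \<le> r * r" using dd by (simp flip: ennreal_mult)
    moreover have "0 < r" using r \<open>d \<noteq> 0\<close> by (cases "r = 0") auto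
    ultimately show False using r(3) by (simp add: mult_le_cancel_left1)
  qed
  then show ?thesis using d[OF v] by (simp add: AE_hit_iff)
qed

lemma AE_T_nonempty:
  assumes "v \<in> C" "AE \<omega> in T v. P \<omega>" shows "\<exists>\<omega>. P \<omega>"
proof (rule ccontr)
  assume "\<nexists>\<omega>. P \<omega>"
  then have "AE \<omega> in T v. False" using assms(2) by simp
  then show False using prob_space.AE_False[OF prob_space_T[OF assms(1)]] by simp
qed

lemma AE_hit_reach:
  assumes "v \<in> C" "AE \<omega> in T v. \<exists>i. \<omega> !! i \<in> F"
  shows "\<exists>a\<in>F. (v, a) \<in> (chain_rel K)\<^sup>*"
proof -
  have "AE \<omega> in T v. (\<exists>i. \<omega> !! i \<in> F) \<and> (\<forall>i. (v, \<omega> !! i) \<in> (chain_rel K)\<^sup>*)"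
    using assms AE_reach by (intro AE_conjI)
  from AE_T_nonempty[OF assms(1) this] show ?thesis by blast
qed

text \<open>The hitting assumption holds at every node of the closed set \<open>D\<close>, so it can
  be applied afresh after any number of steps.\<close>

lemma AE_infinitely_often:
  assumes D: "D \<subseteq> C" "\<And>v. v \<in> D \<Longrightarrow> set_pmf (K v) \<subseteq> D"
    and hit: "\<And>v. v \<in> D \<Longrightarrow> AE \<omega> in T v. \<exists>i. \<omega> !! i \<in> U"
    and v: "v \<in> D"
  shows "AE \<omega> in T v. infinite {i. \<omega> !! i \<in> U}"
proof -
  have "AE \<omega> in T v. \<exists>i\<ge>N. \<omega> !! i \<in> U" for N
    using v
  proof (induction N arbitrary: v)
    case 0 then show ?case using hit by simp
  next
    case (Suc N)
    have [measurable]: "Measurable.pred SS (\<lambda>\<omega>. \<omega> !! i \<in> U)" for i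
      using pred_snth[of "\<lambda>w. w \<in> U"] .
    have "(\<exists>i\<ge>Suc N. (v ## \<omega>) !! i \<in> U) \<longleftrightarrow> (\<exists>i\<ge>N. \<omega> !! i \<in> U)" for \<omega>
      by (metis Suc_le_D Suc_le_mono snth.simps(2) stream.sel(2))
    moreover have "AE \<omega> in T w. \<exists>i\<ge>N. \<omega> !! i \<in> U" if "w \<in> set_pmf (K v)" for w
      using Suc.IH[of w] D(2)[OF Suc.prems] that by blast
    ultimately show ?case
      using D(1) Suc.prems by (subst AE_T) (auto simp del: snth.simps)
  qed
  then have "AE \<omega> in T v. \<forall>N. \<exists>i\<ge>N. \<omega> !! i \<in> U" by (simp add: AE_all_countable)
  then show ?thesis by (simp add: infinite_nat_iff_unbounded_le)
qed

section \<open>Parity along a chain\<close>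

text \<open>By recurrence every node reached from \<open>t\<close> still reaches a node
  \<open>u\<close> of colour \<open>c\<close>, so \<open>u\<close> is visited infinitely often
  almost surely, while no larger colour is ever met.\<close>

lemma AE_parity_recurrent:
  assumes t: "t \<in> C" "recurrent (chain_rel K) t" "top_colour (chain_rel K) col t c"
    and c: "c mod 2 = z mod 2"
    and F: "finite F" "\<And>w. (t, w) \<in> (chain_rel K)\<^sup>* \<Longrightarrow> AE \<omega> in T w. \<exists>i. \<omega> !! i \<in> F"
  shows "AE \<omega> in T t. stream_parity col z \<omega>"
proof -
  define D where "D = {w. (t, w) \<in> (chain_rel K)\<^sup>*}"
  obtain u where u: "(t, u) \<in> (chain_rel K)\<^sup>*" "col u = c"
    and max: "\<And>w. (t, w) \<in> (chain_rel K)\<^sup>* \<Longrightarrow> col w \<le> c"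
    using t(3) unfolding top_colour_def by auto
  have D: "D \<subseteq> C" "\<And>v. v \<in> D \<Longrightarrow> set_pmf (K v) \<subseteq> D"
    unfolding D_def using reach_C t(1) by (auto simp: chain_rel_def intro: rtrancl_into_rtrancl)
  have reach_u: "(w, u) \<in> (chain_rel K)\<^sup>*" if "w \<in> D" for w
  proof -
    have "(t, w) \<in> (chain_rel K)\<^sup>*" using that by (simp add: D_def)
    then have "(w, t) \<in> (chain_rel K)\<^sup>*" using t(2) by (simp add: recurrent_def)
    then show ?thesis using u(1) by (rule rtrancl_trans)
  qed
  have FD: "AE \<omega> in T w. \<exists>i. \<omega> !! i \<in> F" if "w \<in> D" for w using F(2) that D_def by simp
  have hit: "AE \<omega> in T w. \<exists>i. \<omega> !! i \<in> {u}" if "w \<in> D" for w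
    by (rule finite_attractor_AE_hit[OF D F(1) FD _ that]) (use reach_u in blast)+
  have "AE \<omega> in T t. infinite {i. \<omega> !! i \<in> {u}}"
    by (rule AE_infinitely_often[OF D hit]) (simp_all add: D_def)
  then have "AE \<omega> in T t. infinite {i. \<omega> !! i \<in> {u}} \<and> (\<forall>i. (t, \<omega> !! i) \<in> (chain_rel K)\<^sup>*)"
    using AE_reach[OF t(1)] by (rule AE_conjI)
  then show ?thesis
  proof (rule eventually_mono, elim conjE)
    fix \<omega> assume inf: "infinite {i. \<omega> !! i \<in> {u}}" and reach: "\<forall>i. (t, \<omega> !! i) \<in> (chain_rel K)\<^sup>*"
    have "infinite {i. col (\<omega> !! i) = c}"
      using inf by (rule infinite_super[rotated]) (use u(2) in auto)
    moreover have "d \<le> c" if "infinite {i. col (\<omega> !! i) = d}" for d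
    proof -
      have "{i. col (\<omega> !! i) = d} \<noteq> {}" using that by (metis finite.emptyI)
      then obtain i where "col (\<omega> !! i) = d" by blast
      then show ?thesis using max reach by auto
    qed
    ultimately show "stream_parity col z \<omega>" using c unfolding stream_parity_def by blast
  qed
qed

text \<open>The failure probability \<open>miss\<close> is harmonic and vanishes on the recurrent
  nodes \<open>Rec\<close>. Unfolding it \<open>N\<close> times bounds it by the chance that
  \<open>Rec\<close> has not been met yet, and \<open>Rec\<close> is met almost surely.\<close>

theorem AE_parity:
  assumes v: "v \<in> C"
    and F: "finite F" "\<And>w. (v, w) \<in> (chain_rel K)\<^sup>* \<Longrightarrow> AE \<omega> in T w. \<exists>i. \<omega> !! i \<in> F"
    and good: "\<And>t. (v, t) \<in> (chain_rel K)\<^sup>* \<Longrightarrow> recurrent (chain_rel K) t \<Longrightarrow>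
      \<exists>c. top_colour (chain_rel K) col t c \<and> c mod 2 = z mod 2"
  shows "AE \<omega> in T v. stream_parity col z \<omega>"
proof -
  define D where "D = {w. (v, w) \<in> (chain_rel K)\<^sup>*}"
  define Rec where "Rec = {t \<in> D. recurrent (chain_rel K) t}"
  define miss where "miss = (\<lambda>w. emeasure (T w) {\<omega>. \<not> stream_parity col z \<omega>})"
  have D: "D \<subseteq> C" "\<And>v. v \<in> D \<Longrightarrow> set_pmf (K v) \<subseteq> D"
    unfolding D_def using reach_C v by (auto simp: chain_rel_def intro: rtrancl_into_rtrancl)
  have vD: "v \<in> D" by (simp add: D_def)
  have DD: "w' \<in> D" if "w \<in> D" "(w, w') \<in> (chain_rel K)\<^sup>*" for w w'
    using that unfolding D_def by (auto intro: rtrancl_trans)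
  have FD: "AE \<omega> in T w. \<exists>i. \<omega> !! i \<in> F" if "w \<in> D" for w using F(2) that D_def by simp
  have reach_Rec: "\<exists>u\<in>Rec. (w, u) \<in> (chain_rel K)\<^sup>*" if "w \<in> D" for w
  proof -
    have "\<exists>t. (w, t) \<in> (chain_rel K)\<^sup>* \<and> recurrent (chain_rel K) t"
    proof (rule reaches_recurrent[OF F(1)])
      fix w' assume "(w, w') \<in> (chain_rel K)\<^sup>*"
      then have "w' \<in> D" using DD[OF that] by simp
      then show "\<exists>a\<in>F. (w', a) \<in> (chain_rel K)\<^sup>*" using FD D(1) by (intro AE_hit_reach) auto
    qed
    then show ?thesis using DD[OF that] unfolding Rec_def by blast
  qed
  have "AE \<omega> in T v. \<exists>i. \<omega> !! i \<in> Rec"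
    by (rule finite_attractor_AE_hit[OF D F(1) FD _ vD]) (use reach_Rec in blast)+
  then have avoid0: "avoid Rec v = 0" by (simp add: AE_hit_iff)
  have sets: "{\<omega>. \<not> stream_parity col z \<omega>} \<in> sets SS"
    using pred_intros_logic(2)[OF pred_stream_parity, of col z] by (simp add: pred_def space_stream_space)
  have miss0: "miss w = 0 \<longleftrightarrow> (AE \<omega> in T w. stream_parity col z \<omega>)" for w
    unfolding miss_def using sets by (subst AE_iff_measurable[OF _ refl]) auto
  have miss_step: "miss w = (\<integral>\<^sup>+ w'. miss w' \<partial>K w)" if "w \<in> C" for w
    unfolding miss_def using that by (subst emeasure_T) (simp_all add: stream_parity_Stream)
  have miss_Rec: "miss t = 0" if "t \<in> Rec" for t
  proof -
    have t: "t \<in> C" "(v, t) \<in> (chain_rel K)\<^sup>*" "t \<in> D" "recurrent (chain_rel K) t"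
      using that D(1) unfolding Rec_def D_def by auto
    then obtain c where "top_colour (chain_rel K) col t c" "c mod 2 = z mod 2" using good by blast
    then show ?thesis
      unfolding miss0 by (rule AE_parity_recurrent[OF t(1,4) _ _ F(1)]) (rule FD[OF DD[OF t(3)]])
  qed
  have "miss w \<le> avoid_upto Rec N w" if "w \<in> D" for N w
    using that
  proof (induction N arbitrary: w)
    case 0
    then have "w \<in> C" using D(1) by auto
    then show ?case
      unfolding miss_def avoid_upto_0[OF \<open>w \<in> C\<close>] using prob_space.measure_le_1[OF prob_space_T] by blast
  next
    case (Suc N)
    have wC: "w \<in> C" using Suc D by auto
    show ?case
    proof (cases "w \<in> Rec")
      case False
      have "miss w = (\<integral>\<^sup>+ w'. miss w' \<partial>K w)" by (rule miss_step[OF wC])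
      also have "\<dots> \<le> (\<integral>\<^sup>+ w'. avoid_upto Rec N w' \<partial>K w)"
        using Suc.IH D(2)[OF Suc.prems] by (intro nn_integral_mono_AE) (auto simp: AE_measure_pmf_iff)
      finally show ?thesis using False by (simp add: avoid_upto_step[OF wC])
    qed (simp add: miss_Rec)
  qed
  then have "miss v \<le> avoid Rec v"
    using avoid_upto_LIMSEQ[OF v, of Rec] vD by (intro LIMSEQ_le_const) auto
  then show ?thesis using avoid0 miss0 by auto
qed

text \<open>An event that is null at \<open>v\<close> is null at every successor of
  \<open>v\<close>; prefix independence carries this along the path to \<open>t\<close>.\<close>

lemma parity_positive:
  assumes "(v, t) \<in> (chain_rel K)\<^sup>*" "v \<in> C" "AE \<omega> in T t. stream_parity col z \<omega>"
  shows "\<not> (AE \<omega> in T v. \<not> stream_parity col z \<omega>)"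
  using assms
proof (induction rule: converse_rtrancl_induct)
  case base
  show ?case
  proof
    assume "AE \<omega> in T t. \<not> stream_parity col z \<omega>"
    then have "AE \<omega> in T t. stream_parity col z \<omega> \<and> \<not> stream_parity col z \<omega>"
      using base(2) by (intro AE_conjI)
    from AE_T_nonempty[OF base(1) this] show False by blast
  qed
next
  case (step v w)
  then have "w \<in> set_pmf (K v)" "w \<in> C" using closed_C by (auto simp: chain_rel_def)
  then show ?case
    using step by (subst AE_T) (auto simp: stream_parity_Stream)
qed

end

section \<open>Positional winning regions\<close>

text \<open>When both players use finite memory, one chain on pairs of a state and a memory value
  describes the play: kap s m is the move made in the player state s with memory m.\<close>

definition step_rel ::
    "'s game \<Rightarrow> ('s \<Rightarrow> nat \<Rightarrow> 's) \<Rightarrow> ('s \<Rightarrow> nat \<Rightarrow> nat) \<Rightarrow> (('s \<times> nat) \<times> ('s \<times> nat)) set" where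
  "step_rel G kap mu =
     {((s, m), (t, m')). m' = mu s m \<and> (if s \<in> SR G then (s, t) \<in> E G else t = kap s m)}"

text \<open>Moves need to be legal only for memory values in \<open>M\<close>, because a play
  started in \<open>M\<close> never leaves it.\<close>

definition valid_memory ::
    "'s game \<Rightarrow> ('s \<Rightarrow> nat \<Rightarrow> 's) \<Rightarrow> ('s \<Rightarrow> nat \<Rightarrow> nat) \<Rightarrow> nat set \<Rightarrow> bool" where
  "valid_memory G kap mu M \<longleftrightarrow> finite M \<and>
     (\<forall>s. \<forall>m\<in>M. mu s m \<in> M \<and> (s \<notin> SR G \<longrightarrow> (s, kap s m) \<in> E G))"

definition node_colour :: "'s game \<Rightarrow> 's \<times> nat \<Rightarrow> nat" where
  "node_colour G v = Col G (fst v)"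

text \<open>In a chain with a finite attractor this is the combinatorial form of
  ``z-Parity holds with positive probability''.\<close>
definition parity_possible ::
    "'s game \<Rightarrow> nat \<Rightarrow> ('s \<Rightarrow> nat \<Rightarrow> 's) \<Rightarrow> ('s \<Rightarrow> nat \<Rightarrow> nat) \<Rightarrow> 's \<times> nat \<Rightarrow> bool" where
  "parity_possible G z kap mu v \<longleftrightarrow>
     (\<exists>t c. (v, t) \<in> (step_rel G kap mu)\<^sup>* \<and> recurrent (step_rel G kap mu) t \<and>
        top_colour (step_rel G kap mu) (node_colour G) t c \<and> c mod 2 = z mod 2)"

text \<open>Only moves made inside V are constrained. This is what makes positional winning regions
  closed under unions.\<close>
definition follows ::
    "'s game \<Rightarrow> nat \<Rightarrow> 's set \<Rightarrow> 's set \<Rightarrow> ('s \<Rightarrow> 's) \<Rightarrow>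
     ('s \<Rightarrow> nat \<Rightarrow> 's) \<Rightarrow> ('s \<Rightarrow> nat \<Rightarrow> nat) \<Rightarrow> 's \<times> nat \<Rightarrow> bool" where
  "follows G z H V f kap mu v \<longleftrightarrow>
     (\<forall>s m. (v, (s, m)) \<in> (step_rel G kap mu)\<^sup>* \<and> s \<in> V \<longrightarrow>
        (s \<in> player_states G z \<longrightarrow> kap s m = f s) \<and>
        (s \<in> player_states G (1 - z) \<longrightarrow> kap s m \<in> H))"

text \<open>One \<open>kap\<close> carries the moves of both players, so the quantifier ranges over
  all finite-memory opponents at once. After leaving \<open>V\<close> the play is arbitrary and may
  even leave \<open>H\<close>; \<open>\<psi>\<close> must hold at the start node all the
  same.\<close>

definition secures ::
    "'s game \<Rightarrow> (('s \<Rightarrow> nat \<Rightarrow> 's) \<Rightarrow> ('s \<Rightarrow> nat \<Rightarrow> nat) \<Rightarrow> 's \<times> nat \<Rightarrow> bool) \<Rightarrow>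
     nat \<Rightarrow> 's set \<Rightarrow> 's set \<Rightarrow> ('s \<Rightarrow> 's) \<Rightarrow> bool" where
  "secures G \<psi> z H V f \<longleftrightarrow> V \<subseteq> H \<and>
     (\<forall>s \<in> V \<inter> player_states G z. (s, f s) \<in> E G \<and> f s \<in> H) \<and>
     (\<forall>kap mu M v. valid_memory G kap mu M \<and> snd v \<in> M \<and> fst v \<in> V \<and>
        follows G z H V f kap mu v \<longrightarrow> \<psi> kap mu v)"

definition region ::
    "'s game \<Rightarrow> (('s \<Rightarrow> nat \<Rightarrow> 's) \<Rightarrow> ('s \<Rightarrow> nat \<Rightarrow> nat) \<Rightarrow> 's \<times> nat \<Rightarrow> bool) \<Rightarrow>
     nat \<Rightarrow> 's set \<Rightarrow> 's set" where
  "region G \<psi> z H = \<Union>{V. \<exists>f. secures G \<psi> z H V f}"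

text \<open>The abstract form of a positive-probability objective: it is enough to reach a node from
  which it holds. Both parity and reachability objectives are used, the latter to obtain attractors
  as regions.\<close>

definition eventual ::
    "'s game \<Rightarrow> (('s \<Rightarrow> nat \<Rightarrow> 's) \<Rightarrow> ('s \<Rightarrow> nat \<Rightarrow> nat) \<Rightarrow> 's \<times> nat \<Rightarrow> bool) \<Rightarrow> bool" where
  "eventual G \<psi> \<longleftrightarrow>
     (\<forall>kap mu v w. (v, w) \<in> (step_rel G kap mu)\<^sup>* \<longrightarrow> \<psi> kap mu w \<longrightarrow> \<psi> kap mu v)"

text \<open>With the edges inside \<open>H\<close>, this is again a game: chance cannot leave
  \<open>H\<close> and a player is never forced to.\<close>

definition subarena :: "'s game \<Rightarrow> 's set \<Rightarrow> bool" where
  "subarena G H \<longleftrightarrow> (\<forall>s\<in>H. (s \<in> SR G \<longrightarrow> (\<forall>t. (s, t) \<in> E G \<longrightarrow> t \<in> H)) \<and> (\<exists>t\<in>H. (s, t) \<in> E G))"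

lemma eventualD: "eventual G \<psi> \<Longrightarrow> (v, w) \<in> (step_rel G kap mu)\<^sup>* \<Longrightarrow> \<psi> kap mu w \<Longrightarrow> \<psi> kap mu v"
  unfolding eventual_def by blast

lemma eventual_parity_possible: "eventual G (parity_possible G z)"
  unfolding eventual_def parity_possible_def by (meson rtrancl_trans)

lemma eventual_reach: "eventual G (\<lambda>kap mu v. \<exists>w. (v, w) \<in> (step_rel G kap mu)\<^sup>* \<and> fst w \<in> Q)"
  unfolding eventual_def by (meson rtrancl_trans)

lemma follows_reach:
  "follows G z H V f kap mu v \<Longrightarrow> (v, w) \<in> (step_rel G kap mu)\<^sup>* \<Longrightarrow> follows G z H V f kap mu w"
  unfolding follows_def by (meson rtrancl_trans)

lemma valid_memory_reach:
  assumes "(v, w) \<in> (step_rel G kap mu)\<^sup>*" "valid_memory G kap mu M" "snd v \<in> M"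
  shows "snd w \<in> M"
  using assms by (induction rule: rtrancl_induct) (auto simp: step_rel_def valid_memory_def)

lemma securesD:
  assumes "secures G \<psi> z H V f"
  shows "V \<subseteq> H" "\<And>s. s \<in> V \<Longrightarrow> s \<in> player_states G z \<Longrightarrow> (s, f s) \<in> E G"
    "\<And>s. s \<in> V \<Longrightarrow> s \<in> player_states G z \<Longrightarrow> f s \<in> H"
    "\<And>kap mu M v. valid_memory G kap mu M \<Longrightarrow> snd v \<in> M \<Longrightarrow> fst v \<in> V \<Longrightarrow>
      follows G z H V f kap mu v \<Longrightarrow> \<psi> kap mu v"
  using assms unfolding secures_def by blast+

lemma secures_region_subset: "secures G \<psi> z H V f \<Longrightarrow> V \<subseteq> region G \<psi> z H"
  unfolding region_def by blast

lemma region_subset: "region G \<psi> z H \<subseteq> H"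
  unfolding region_def secures_def by blast

text \<open>Play in every state the strategy of the least region containing it, for some well-order of
  the regions. Along a play the index can only decrease, and as long as it stays constant a single
  strategy is followed.\<close>
lemma region_secures:
  assumes ev: "eventual G \<psi>"
  shows "\<exists>f. secures G \<psi> z H (region G \<psi> z H) f"
proof -
  define \<V> where "\<V> = {V. \<exists>f. secures G \<psi> z H V f}"
  define st where "st = (\<lambda>V. SOME f. secures G \<psi> z H V f)"
  have st: "secures G \<psi> z H V (st V)" if "V \<in> \<V>" for V
  proof -
    have "\<exists>f. secures G \<psi> z H V f" using that unfolding \<V>_def by simp
    then show ?thesis unfolding st_def by (rule someI_ex)
  qed
  obtain r :: "'a set rel" where "well_order_on UNIV r"
    using well_order_on by blast
  then have wf: "wf (r - Id)" and total: "\<And>U V. U \<noteq> V \<Longrightarrow> (U, V) \<in> r \<or> (V, U) \<in> r"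
    unfolding well_order_on_def linear_order_on_def total_on_def by auto
  have "\<forall>s\<in>\<Union>\<V>. \<exists>V. V \<in> \<V> \<and> s \<in> V \<and> (\<forall>U. (U, V) \<in> r - Id \<longrightarrow> \<not> (U \<in> \<V> \<and> s \<in> U))"
  proof
    fix s assume "s \<in> \<Union>\<V>"
    then obtain V0 where "V0 \<in> \<V>" "s \<in> V0" by (rule UnionE)
    then have "V0 \<in> {V \<in> \<V>. s \<in> V}" by simp
    from wfE_min[OF wf this] obtain V where
      "V \<in> {V \<in> \<V>. s \<in> V}" "\<And>U. (U, V) \<in> r - Id \<Longrightarrow> U \<notin> {V \<in> \<V>. s \<in> V}" by metis
    then show "\<exists>V. V \<in> \<V> \<and> s \<in> V \<and> (\<forall>U. (U, V) \<in> r - Id \<longrightarrow> \<not> (U \<in> \<V> \<and> s \<in> U))"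
      by (intro exI[of _ V]) simp
  qed
  from bchoice[OF this] obtain idx where
    idx_all: "\<forall>s\<in>\<Union>\<V>. idx s \<in> \<V> \<and> s \<in> idx s \<and> (\<forall>U. (U, idx s) \<in> r - Id \<longrightarrow> \<not> (U \<in> \<V> \<and> s \<in> U))" ..
  have idx: "idx s \<in> \<V>" "s \<in> idx s" if "s \<in> \<Union>\<V>" for s using bspec[OF idx_all that] by simp_all
  have idx_min: "s \<notin> U" if "s \<in> \<Union>\<V>" "(U, idx s) \<in> r - Id" "U \<in> \<V>" for s U
    using bspec[OF idx_all that(1)] that(2,3) by simp
  define f where "f = (\<lambda>s. st (idx s) s)"
  have claim: "\<psi> kap mu v"
    if "valid_memory G kap mu M" "snd v \<in> M" "fst v \<in> \<Union>\<V>" "follows G z H (\<Union>\<V>) f kap mu v" "idx (fst v) = i"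
    for kap mu M v i
    using wf that
  proof (induction i arbitrary: v rule: wf_induct_rule)
    case (less i)
    show ?case
    proof (cases "\<exists>w. (v, w) \<in> (step_rel G kap mu)\<^sup>* \<and> fst w \<in> \<Union>\<V> \<and> (idx (fst w), i) \<in> r - Id")
      case True
      then obtain w where w: "(v, w) \<in> (step_rel G kap mu)\<^sup>*" "fst w \<in> \<Union>\<V>" "(idx (fst w), i) \<in> r - Id"
        by blast
      have "\<psi> kap mu w"
        using less.IH[OF w(3) less.prems(1) valid_memory_reach[OF w(1) less.prems(1,2)] w(2)
            follows_reach[OF less.prems(4) w(1)] refl] .
      then show ?thesis using eventualD[OF ev w(1)] by blast
    next
      case False
      have i: "i \<in> \<V>" "fst v \<in> i" using idx[OF less.prems(3)] less.prems(5) by auto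
      \<comment> \<open>For a reached \<open>s\<close> in \<open>i\<close>, the index of
        \<open>s\<close> is not below \<open>i\<close> by the case assumption, and not above it
        because \<open>i\<close> is itself a secured set containing \<open>s\<close>.\<close>
      have "idx s = i" if "(v, (s, m)) \<in> (step_rel G kap mu)\<^sup>*" "s \<in> i" for s m
      proof (rule ccontr)
        assume ne: "idx s \<noteq> i"
        have s: "s \<in> \<Union>\<V>" using that i by blast
        then have "(idx s, i) \<notin> r - Id" using False that(1) by fastforce
        then have "(i, idx s) \<in> r - Id" using total[OF ne] ne by blast
        then show False using idx_min[OF s] i(1) that(2) by blast
      qed
      then have "follows G z H i (st i) kap mu v"
        using less.prems(4) i(1) unfolding follows_def f_def by (metis UnionI)
      then show ?thesis using securesD(4)[OF st[OF i(1)] less.prems(1,2) i(2)] by blast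
    qed
  qed
  have "secures G \<psi> z H (\<Union>\<V>) f"
    unfolding secures_def
  proof (intro conjI allI impI ballI)
    show "\<Union>\<V> \<subseteq> H" unfolding \<V>_def secures_def by blast
    show "(s, f s) \<in> E G" "f s \<in> H" if "s \<in> \<Union>\<V> \<inter> player_states G z" for s
      using that idx securesD(2,3)[OF st] unfolding f_def by auto
  qed (use claim in blast)
  then show ?thesis unfolding region_def \<V>_def by blast
qed

text \<open>The form in which maximality is used. Play the region's own strategy inside the region
  and \<open>g\<close> elsewhere: a play that meets the region is won by backward inheritance, so
  \<open>g\<close> has to handle only plays that never do.\<close>

lemma region_extend:
  assumes ev: "eventual G \<psi>" and N: "N \<subseteq> H"
    and g: "\<And>s. s \<in> N \<Longrightarrow> s \<in> player_states G z \<Longrightarrow> (s, g s) \<in> E G \<and> g s \<in> H"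
    and win: "\<And>kap mu M v. valid_memory G kap mu M \<Longrightarrow> snd v \<in> M \<Longrightarrow> fst v \<in> N \<Longrightarrow>
      (\<And>w. (v, w) \<in> (step_rel G kap mu)\<^sup>* \<Longrightarrow> fst w \<notin> region G \<psi> z H) \<Longrightarrow>
      follows G z H N g kap mu v \<Longrightarrow> \<psi> kap mu v"
  shows "N \<subseteq> region G \<psi> z H"
proof -
  define V where "V = region G \<psi> z H"
  obtain f where f: "secures G \<psi> z H V f" using region_secures[OF ev] unfolding V_def by blast
  define h where "h = (\<lambda>s. if s \<in> V then f s else g s)"
  have "secures G \<psi> z H (V \<union> N) h"
    unfolding secures_def
  proof (intro conjI allI impI ballI)
    show "V \<union> N \<subseteq> H" using N securesD(1)[OF f] by blast
    show "(s, h s) \<in> E G" "h s \<in> H" if "s \<in> (V \<union> N) \<inter> player_states G z" for s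
      using that securesD(2,3)[OF f] g unfolding h_def by auto
  next
    fix kap mu M v
    assume *: "valid_memory G kap mu M \<and> snd v \<in> M \<and> fst v \<in> V \<union> N \<and> follows G z H (V \<union> N) h kap mu v"
    show "\<psi> kap mu v"
    proof (cases "\<exists>w. (v, w) \<in> (step_rel G kap mu)\<^sup>* \<and> fst w \<in> V")
      case True
      then obtain w where w: "(v, w) \<in> (step_rel G kap mu)\<^sup>*" "fst w \<in> V" by blast
      have "follows G z H (V \<union> N) h kap mu w" using follows_reach w(1) * by blast
      then have "follows G z H V f kap mu w" unfolding follows_def h_def by auto
      then have "\<psi> kap mu w" using securesD(4)[OF f] valid_memory_reach[OF w(1)] * w(2) by blast
      then show ?thesis using eventualD[OF ev w(1)] by blast
    next
      case False
      then have never: "fst w \<notin> V" if "(v, w) \<in> (step_rel G kap mu)\<^sup>*" for w using that by blast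
      then have "follows G z H N g kap mu v"
        using * unfolding follows_def h_def by (metis UnCI fst_conv)
      moreover have "fst v \<in> N" using * never[of v] by blast
      ultimately show ?thesis using win[of kap mu M v] * never unfolding V_def by blast
    qed
  qed
  then show ?thesis using secures_region_subset unfolding V_def by blast
qed

section \<open>One-step closure of regions, and traps\<close>

locale arena =
  fixes G :: "'s game" and n :: nat
  assumes game: "is_game G n"
begin

lemma state_cases:
  assumes "z \<le> 1"
  obtains "s \<in> player_states G z" "s \<notin> SR G" "s \<notin> player_states G (1 - z)"
  | "s \<in> player_states G (1 - z)" "s \<notin> SR G" "s \<notin> player_states G z"
  | "s \<in> SR G" "s \<notin> player_states G z" "s \<notin> player_states G (1 - z)"
proof -
  have "z = 0 \<or> z = 1" using assms by auto
  moreover have "s \<in> S0 G \<or> s \<in> S1 G \<or> s \<in> SR G" "\<not> (s \<in> S0 G \<and> s \<in> S1 G)"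
    "\<not> (s \<in> S0 G \<and> s \<in> SR G)" "\<not> (s \<in> S1 G \<and> s \<in> SR G)"
    using game unfolding is_game_def by auto
  ultimately show ?thesis using that unfolding player_states_def by auto
qed

lemma step_random: "s \<in> SR G \<Longrightarrow> (s, t) \<in> E G \<Longrightarrow> ((s, m), (t, mu s m)) \<in> step_rel G kap mu"
  by (simp add: step_rel_def)

lemma step_player: "s \<notin> SR G \<Longrightarrow> ((s, m), (kap s m, mu s m)) \<in> step_rel G kap mu"
  by (simp add: step_rel_def)

lemma player_not_random: "z \<le> 1 \<Longrightarrow> s \<in> player_states G z \<Longrightarrow> s \<notin> SR G"
  using state_cases[of z s] by blast

text \<open>With \<open>N = {s}\<close> the winning condition of \<open>region_extend\<close> is
  vacuous: the very first move enters the region. The next two lemmas use the same argument for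
  chance and for the opponent.\<close>

lemma region_own:
  assumes "z \<le> 1" "eventual G \<psi>" "s \<in> H" "s \<in> player_states G z" "(s, t) \<in> E G" "t \<in> region G \<psi> z H"
  shows "s \<in> region G \<psi> z H"
proof -
  have "{s} \<subseteq> region G \<psi> z H"
  proof (rule region_extend[OF assms(2), where g = "\<lambda>_. t"])
    fix kap mu M v
    assume v: "fst v \<in> {s}" and never: "\<And>w. (v, w) \<in> (step_rel G kap mu)\<^sup>* \<Longrightarrow> fst w \<notin> region G \<psi> z H"
      and fol: "follows G z H {s} (\<lambda>_. t) kap mu v"
    obtain m where [simp]: "v = (s, m)" using v by (cases v) auto
    have "kap s m = t" using fol assms(4) unfolding follows_def by auto
    then have "fst (t, mu s m) \<notin> region G \<psi> z H"
      using step_player[of s m kap mu] player_not_random[OF assms(1,4)] by (intro never) auto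
    then show "\<psi> kap mu v" using assms(6) by simp
  qed (use assms region_subset[of G \<psi> z H] in auto)
  then show ?thesis by simp
qed

lemma region_random:
  assumes "z \<le> 1" "eventual G \<psi>" "s \<in> H" "s \<in> SR G" "(s, t) \<in> E G" "t \<in> region G \<psi> z H"
  shows "s \<in> region G \<psi> z H"
proof -
  have "{s} \<subseteq> region G \<psi> z H"
  proof (rule region_extend[OF assms(2), where g = "\<lambda>_. t"])
    fix kap mu M v
    assume v: "fst v \<in> {s}" and never: "\<And>w. (v, w) \<in> (step_rel G kap mu)\<^sup>* \<Longrightarrow> fst w \<notin> region G \<psi> z H"
    obtain m where [simp]: "v = (s, m)" using v by (cases v) auto
    have "fst (t, mu s m) \<notin> region G \<psi> z H"
      using step_random[OF assms(4,5)] by (intro never) auto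
    then show "\<psi> kap mu v" using assms(6) by simp
  qed (use assms player_not_random in auto)
  then show ?thesis by simp
qed

lemma region_opponent:
  assumes "z \<le> 1" "eventual G \<psi>" "s \<in> H" "s \<in> player_states G (1 - z)"
    and all: "\<And>t. (s, t) \<in> E G \<Longrightarrow> t \<in> H \<Longrightarrow> t \<in> region G \<psi> z H"
  shows "s \<in> region G \<psi> z H"
proof -
  have "{s} \<subseteq> region G \<psi> z H"
  \<comment> \<open>\<open>s\<close> belongs to the opponent, so \<open>id\<close> is only a
    placeholder strategy.\<close>
  proof (rule region_extend[OF assms(2), where g = id])
    show "(s', id s') \<in> E G \<and> id s' \<in> H" if "s' \<in> {s}" "s' \<in> player_states G z" for s'
      using that assms(1,4) state_cases[of z s] by blast
  next
    fix kap mu M v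
    assume v: "fst v \<in> {s}" and never: "\<And>w. (v, w) \<in> (step_rel G kap mu)\<^sup>* \<Longrightarrow> fst w \<notin> region G \<psi> z H"
      and fol: "follows G z H {s} id kap mu v" and M: "valid_memory G kap mu M" "snd v \<in> M"
    obtain m where [simp]: "v = (s, m)" using v by (cases v) auto
    have sR: "s \<notin> SR G" using player_not_random[OF _ assms(4)] by simp
    have "kap s m \<in> H" using fol assms(4) unfolding follows_def by auto
    moreover have "(s, kap s m) \<in> E G" using M sR unfolding valid_memory_def by auto
    moreover have "fst (kap s m, mu s m) \<notin> region G \<psi> z H"
      using step_player[OF sR] by (intro never) auto
    ultimately show "\<psi> kap mu v" using all by auto
  qed (use assms in auto)
  then show ?thesis by simp
qed

text \<open>The contrapositives of the three closure lemmas: outside the region, chance and Player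
  \<open>z\<close> have no edge into it from a state of \<open>H\<close>, and the opponent has at
  least one edge that stays in \<open>H\<close> and avoids it.\<close>

lemma subarena_complement:
  assumes z: "z \<le> 1" and ev: "eventual G \<psi>" and H: "subarena G H"
  shows "subarena G (H - region G \<psi> z H)"
  unfolding subarena_def
proof (intro ballI conjI impI allI)
  fix s assume s: "s \<in> H - region G \<psi> z H"
  show "t \<in> H - region G \<psi> z H" if "s \<in> SR G" "(s, t) \<in> E G" for t
    using that s H region_random[OF z ev, of s H t] unfolding subarena_def by blast
  obtain t where t: "t \<in> H" "(s, t) \<in> E G" using H s unfolding subarena_def by blast
  show "\<exists>t\<in>H - region G \<psi> z H. (s, t) \<in> E G"
    using s t region_own[OF z ev, of s H t] region_random[OF z ev, of s H t] region_opponent[OF z ev, of s H]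
    by (cases rule: state_cases[OF z, of s]) blast+
qed

text \<open>Player \<open>z\<close> and chance have no edge from \<open>G'\<close> into the region,
  and the opponent's \<open>f\<close> keeps to \<open>G'\<close>. The assumption
  \<open>follows\<close> keeps the moves of \<open>z\<close> inside \<open>H\<close>.\<close>

lemma complement_trap:
  assumes z: "z \<le> 1" and ev: "eventual G \<psi>" and H: "subarena G H"
    and G': "G' = H - region G \<psi> z H"
    and M: "valid_memory G kap mu M" "snd v \<in> M" and v: "fst v \<in> G'"
    and fol: "follows G (1 - z) H G' f kap mu v"
    and f: "\<And>s. s \<in> G' \<Longrightarrow> s \<in> player_states G (1 - z) \<Longrightarrow> f s \<in> G'"
    and w: "(v, w) \<in> (step_rel G kap mu)\<^sup>*"
  shows "fst w \<in> G'"
  using w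
proof (induction rule: rtrancl_induct)
  case base show ?case by (rule v)
next
  case (step w w')
  obtain s m where w: "w = (s, m)" by (cases w)
  have sG: "s \<in> G'" using step.IH w by simp
  have m: "m \<in> M" using valid_memory_reach[OF step.hyps(1) M] w by simp
  obtain t where w': "w' = (t, mu s m)" and t: "if s \<in> SR G then (s, t) \<in> E G else t = kap s m"
    using step.hyps(2) w unfolding step_rel_def by auto
  have fol': "(s \<in> player_states G (1 - z) \<longrightarrow> kap s m = f s) \<and> (s \<in> player_states G z \<longrightarrow> kap s m \<in> H)"
    using fol step.hyps(1) sG z unfolding follows_def w by (metis diff_diff_cancel)
  have kE: "(s, kap s m) \<in> E G" if "s \<notin> SR G" using that M(1) m unfolding valid_memory_def by blast
  have "t \<in> G'"
  proof (cases rule: state_cases[OF z, of s])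
    case 1
    then have "t \<in> H" "(s, t) \<in> E G" using t fol' kE by auto
    then show ?thesis using region_own[OF z ev, of s H t] sG 1 unfolding G' by blast
  next
    case 2 then show ?thesis using t fol' f[OF sG] by auto
  next
    case 3
    have "subarena G G'" unfolding G' by (rule subarena_complement[OF z ev H])
    moreover have "(s, t) \<in> E G" using 3 t by simp
    ultimately show ?thesis using sG 3(1) unfolding subarena_def by blast
  qed
  then show ?case using w' by simp
qed

end

text \<open>\<open>attracts\<close> is the only trace of the probabilistic attractor that the
  induction on colours sees.\<close>

locale finite_attractor_arena = arena G n for G :: "'s game" and n +
  fixes A :: "'s set"
  assumes finite_A: "finite A"
    and attracts: "valid_memory G kap mu M \<Longrightarrow> snd v \<in> M \<Longrightarrow>
      \<exists>w. (v, w) \<in> (step_rel G kap mu)\<^sup>* \<and> fst w \<in> A"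
begin

text \<open>\<open>A \<times> M\<close> is finite and stays reachable, which is what
  \<open>reaches_recurrent\<close> asks for.\<close>

lemma ex_recurrent:
  assumes M: "valid_memory G kap mu M" "snd v \<in> M"
  shows "\<exists>t. (v, t) \<in> (step_rel G kap mu)\<^sup>* \<and> recurrent (step_rel G kap mu) t"
proof (rule reaches_recurrent)
  show "finite (A \<times> M)" using finite_A M(1) unfolding valid_memory_def by simp
  fix w assume "(v, w) \<in> (step_rel G kap mu)\<^sup>*"
  then have w: "snd w \<in> M" using valid_memory_reach M by blast
  obtain a where a: "(w, a) \<in> (step_rel G kap mu)\<^sup>*" "fst a \<in> A" using attracts[OF M(1) w] by blast
  then have "snd a \<in> M" using valid_memory_reach M(1) w by blast
  then show "\<exists>a\<in>A \<times> M. (w, a) \<in> (step_rel G kap mu)\<^sup>*"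
    using a by (intro bexI[of _ a]) (auto simp: mem_Times_iff)
qed

lemma ex_top_colour: "\<exists>c. top_colour (step_rel G kap mu) (node_colour G) t c"
proof -
  define D where "D = node_colour G ` {u. (t, u) \<in> (step_rel G kap mu)\<^sup>*}"
  have "D \<subseteq> {..n}" using game unfolding D_def is_game_def node_colour_def by auto
  then have fin: "finite D" using finite_subset by blast
  have "node_colour G t \<in> D" unfolding D_def by (rule imageI) simp
  then have ne: "D \<noteq> {}" by blast
  have "top_colour (step_rel G kap mu) (node_colour G) t (Max D)"
    unfolding top_colour_def
  proof (intro conjI allI impI)
    have "Max D \<in> node_colour G ` {u. (t, u) \<in> (step_rel G kap mu)\<^sup>*}"
      using Max_in[OF fin ne] unfolding D_def .
    then show "\<exists>u. (t, u) \<in> (step_rel G kap mu)\<^sup>* \<and> node_colour G u = Max D"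
      by (metis (mono_tags, lifting) imageE mem_Collect_eq)
    show "node_colour G u \<le> Max D" if "(t, u) \<in> (step_rel G kap mu)\<^sup>*" for u
      using that fin by (intro Max_ge) (auto simp: D_def)
  qed
  then show ?thesis by blast
qed

lemma parity_possible_or:
  assumes "valid_memory G kap mu M" "snd v \<in> M" "z \<le> 1"
  shows "parity_possible G z kap mu v \<or> parity_possible G (1 - z) kap mu v"
proof -
  obtain t where t: "(v, t) \<in> (step_rel G kap mu)\<^sup>*" "recurrent (step_rel G kap mu) t"
    using ex_recurrent assms by blast
  obtain c where c: "top_colour (step_rel G kap mu) (node_colour G) t c" using ex_top_colour by blast
  have "c mod 2 = z mod 2 \<or> c mod 2 = (1 - z) mod 2" using assms(3) by (cases z) auto
  then show ?thesis using t c unfolding parity_possible_def by blast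
qed

text \<open>A recurrent class has only one largest colour.\<close>
lemma parity_possible_everywhere:
  assumes "z \<le> 1" and all: "\<And>w. (v, w) \<in> (step_rel G kap mu)\<^sup>* \<Longrightarrow> parity_possible G z kap mu w"
  shows "\<not> parity_possible G (1 - z) kap mu v"
proof
  assume "parity_possible G (1 - z) kap mu v"
  then obtain t c where t: "(v, t) \<in> (step_rel G kap mu)\<^sup>*" "recurrent (step_rel G kap mu) t"
    "top_colour (step_rel G kap mu) (node_colour G) t c" "c mod 2 = (1 - z) mod 2"
    unfolding parity_possible_def by blast
  obtain t' c' where t': "(t, t') \<in> (step_rel G kap mu)\<^sup>*"
    "top_colour (step_rel G kap mu) (node_colour G) t' c'" "c' mod 2 = z mod 2"
    using all[OF t(1)] unfolding parity_possible_def by blast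
  have "(t', t) \<in> (step_rel G kap mu)\<^sup>*" using t(2) t'(1) unfolding recurrent_def by blast
  then have "c = c'"
    using t(3) t'(1,2) unfolding top_colour_def by (meson rtrancl_trans antisym)
  moreover have "z mod 2 \<noteq> (1 - z) mod 2" using assms(1) by (cases z) auto
  ultimately show False using t(4) t'(3) by simp
qed

section \<open>Induction on the number of colours\<close>

text \<open>Impossibility of z-Parity is the combinatorial form of almost sure (1-z)-Parity, so this
  asks for a positional almost-sure strategy on the complement of the region of
  \<open>z\<close>.\<close>

definition determined :: "nat \<Rightarrow> 's set \<Rightarrow> bool" where
  "determined z H \<longleftrightarrow> (\<exists>f. secures G (\<lambda>kap mu v. \<not> parity_possible G z kap mu v) (1 - z) H
      (H - region G (parity_possible G z) z H) f)"

text \<open>The largest colour N belongs to the opponent x of z. Outside the region of z, Player x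
  attracts to N where possible; the rest has smaller colours and there z has no region at all,
  because it would extend the region in H.\<close>
lemma determined_non_owner:
  assumes z: "z \<le> 1" "z \<noteq> N mod 2" and H: "subarena G H" and col: "\<And>s. s \<in> H \<Longrightarrow> Col G s < Suc N"
    and IH: "\<And>H. subarena G H \<Longrightarrow> (\<And>s. s \<in> H \<Longrightarrow> Col G s < N) \<Longrightarrow> determined z H"
  shows "determined z H"
proof -
  define x where "x = 1 - z"
  have x: "x \<le> 1" "1 - x = z" "x = N mod 2" using z unfolding x_def by auto
  define V where "V = region G (parity_possible G z) z H"
  define G' where "G' = H - V"
  note ev = eventual_parity_possible[of G z]
  have G': "subarena G G'" unfolding G'_def V_def by (rule subarena_complement[OF z(1) ev H])
  define Q where "Q = {s \<in> G'. Col G s = N}"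
  define \<psi> where "\<psi> = (\<lambda>kap mu v. \<exists>w. (v, w) \<in> (step_rel G kap mu)\<^sup>* \<and> fst w \<in> Q)"
  have ev\<psi>: "eventual G \<psi>" unfolding \<psi>_def by (rule eventual_reach)
  define Z where "Z = region G \<psi> x G'"
  obtain fZ where fZ: "secures G \<psi> x G' Z fZ" unfolding Z_def using region_secures[OF ev\<psi>] by blast
  \<comment> \<open>At a node over \<open>Q\<close> the objective \<open>\<psi>\<close> holds at
    once; the chosen successor merely supplies a legal move inside \<open>G'\<close>.\<close>
  have "Q \<subseteq> Z"
    unfolding Z_def
  proof (rule region_extend[OF ev\<psi>, where g = "\<lambda>s. SOME t. (s, t) \<in> E G \<and> t \<in> G'"])
    show "(s, SOME t. (s, t) \<in> E G \<and> t \<in> G') \<in> E G \<and> (SOME t. (s, t) \<in> E G \<and> t \<in> G') \<in> G'"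
      if "s \<in> Q" for s
      using G' that someI_ex[of "\<lambda>t. (s, t) \<in> E G \<and> t \<in> G'"] unfolding subarena_def Q_def by blast
  qed (auto simp: Q_def \<psi>_def)
  define G'' where "G'' = G' - Z"
  have G'': "subarena G G''" unfolding G''_def Z_def by (rule subarena_complement[OF x(1) ev\<psi> G'])
  have col'': "Col G s < N" if "s \<in> G''" for s
  proof -
    have "s \<in> G'" "s \<notin> Q" using that \<open>Q \<subseteq> Z\<close> unfolding G''_def by auto
    then have "Col G s < Suc N" "Col G s \<noteq> N" using col[of s] unfolding G'_def Q_def by auto
    then show ?thesis by simp
  qed
  define V'' where "V'' = region G (parity_possible G z) z G''"
  obtain f1 where f1: "secures G (parity_possible G z) z G'' V'' f1"
    unfolding V''_def using region_secures[OF ev] by blast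
  obtain f2 where f2: "secures G (\<lambda>kap mu v. \<not> parity_possible G z kap mu v) x G'' (G'' - V'') f2"
    using IH[OF G'' col''] unfolding determined_def V''_def x_def by blast
  have sub: "V'' \<subseteq> G''" "G'' \<subseteq> G'" "G' \<subseteq> H" using securesD(1)[OF f1] unfolding G''_def G'_def by auto
  have "V'' \<subseteq> region G (parity_possible G z) z H"
  proof (rule region_extend[OF ev, where g = f1])
    show "V'' \<subseteq> H" using sub by blast
    show "(s, f1 s) \<in> E G \<and> f1 s \<in> H" if "s \<in> V''" "s \<in> player_states G z" for s
      using securesD(2,3)[OF f1] that sub by blast
  next
    fix kap mu M v
    assume M: "valid_memory G kap mu M" "snd v \<in> M" and v: "fst v \<in> V''"
      and never: "\<And>w. (v, w) \<in> (step_rel G kap mu)\<^sup>* \<Longrightarrow> fst w \<notin> region G (parity_possible G z) z H"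
      and fol: "follows G z H V'' f1 kap mu v"
    \<comment> \<open>The opponent \<open>x\<close> is only known to stay in \<open>H\<close>. Moves
      into \<open>V\<close> are excluded by \<open>never\<close>, and a move into \<open>Z\<close>
      would put \<open>s\<close> itself into the attractor \<open>Z\<close>, although
      \<open>s\<close> lies in \<open>G''\<close>.\<close>
    have "kap s m \<in> G''"
      if s: "(v, (s, m)) \<in> (step_rel G kap mu)\<^sup>*" "s \<in> V''" "s \<in> player_states G (1 - z)" for s m
    proof -
      have sR: "s \<notin> SR G" using s(3) player_not_random x unfolding x_def by blast
      have m: "m \<in> M" using valid_memory_reach[OF s(1) M] by simp
      have "(v, (kap s m, mu s m)) \<in> (step_rel G kap mu)\<^sup>*"
        using s(1) step_player[OF sR] by (rule rtrancl_into_rtrancl)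
      from never[OF this] have "kap s m \<notin> V" unfolding V_def by simp
      moreover have "kap s m \<in> H" using fol s unfolding follows_def by blast
      ultimately have kG: "kap s m \<in> G'" unfolding G'_def by blast
      moreover have "(s, kap s m) \<in> E G" using M(1) m sR unfolding valid_memory_def by blast
      ultimately have "kap s m \<notin> Z"
        using region_own[OF x(1) ev\<psi>, of s G' "kap s m", folded Z_def] s(2) s(3)[folded x_def] sub(1)
        unfolding G''_def by blast
      then show ?thesis using kG unfolding G''_def by blast
    qed
    then have "follows G z G'' V'' f1 kap mu v" using fol unfolding follows_def by blast
    then show "parity_possible G z kap mu v" using securesD(4)[OF f1 M v] by blast
  qed
  then have V''0: "V'' = {}" using sub unfolding G'_def V_def by blast
  define f where "f = (\<lambda>s. if s \<in> Z then fZ s else f2 s)"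
  have fE: "(s, f s) \<in> E G" "f s \<in> G'" if "s \<in> G'" "s \<in> player_states G x" for s
    using that securesD(2,3)[OF fZ] securesD(2,3)[OF f2] V''0 sub unfolding f_def G''_def by auto
  have "secures G (\<lambda>kap mu v. \<not> parity_possible G z kap mu v) x H G' f"
    unfolding secures_def
  proof (intro conjI allI impI ballI)
    show "G' \<subseteq> H" by (rule sub)
    show "(s, f s) \<in> E G" "f s \<in> H" if "s \<in> G' \<inter> player_states G x" for s
      using fE that sub by auto
  next
    fix kap mu M v
    assume *: "valid_memory G kap mu M \<and> snd v \<in> M \<and> fst v \<in> G' \<and> follows G x H G' f kap mu v"
    have stay: "fst w \<in> G'" if "(v, w) \<in> (step_rel G kap mu)\<^sup>*" for w
      using complement_trap[OF z(1) ev H, of G' kap mu M v f w] * that fE(2)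
      unfolding x_def G'_def V_def by blast
    have stay': "kap s m \<in> G'"
      if "(v, (s, m)) \<in> (step_rel G kap mu)\<^sup>*" "s \<in> player_states G (1 - x)" for s m
      using stay[OF rtrancl_into_rtrancl[OF that(1) step_player]] player_not_random[OF _ that(2)] by simp
    show "\<not> parity_possible G z kap mu v"
    proof
      assume "parity_possible G z kap mu v"
      then obtain t c where t: "(v, t) \<in> (step_rel G kap mu)\<^sup>*" "recurrent (step_rel G kap mu) t"
        "top_colour (step_rel G kap mu) (node_colour G) t c" "c mod 2 = z mod 2"
        unfolding parity_possible_def by blast
      have tM: "snd t \<in> M" using valid_memory_reach[OF t(1)] * by blast
      show False
      \<comment> \<open>If the class of \<open>t\<close> meets \<open>Z\<close>, it contains a node
        of colour \<open>N\<close>, the largest in \<open>G'\<close>, so \<open>c = N\<close> has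
        the parity of \<open>x\<close>. Otherwise the class lies entirely in \<open>G''\<close>,
        where \<open>f\<close> agrees with \<open>f2\<close>.\<close>
      proof (cases "\<exists>w. (t, w) \<in> (step_rel G kap mu)\<^sup>* \<and> fst w \<in> Z")
        case True
        then obtain w where w: "(t, w) \<in> (step_rel G kap mu)\<^sup>*" "fst w \<in> Z" by blast
        then have vw: "(v, w) \<in> (step_rel G kap mu)\<^sup>*" using t(1) by (meson rtrancl_trans)
        have "follows G x G' Z fZ kap mu w"
          unfolding follows_def
        proof (intro allI impI conjI; elim conjE)
          fix s m assume s: "(w, (s, m)) \<in> (step_rel G kap mu)\<^sup>*" "s \<in> Z"
          then have vs: "(v, (s, m)) \<in> (step_rel G kap mu)\<^sup>*" using vw by (meson rtrancl_trans)
          show "kap s m = fZ s" if "s \<in> player_states G x"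
            using * vs that s(2) stay[OF vs] unfolding follows_def f_def by auto
          show "kap s m \<in> G'" if "s \<in> player_states G (1 - x)" by (rule stay'[OF vs that])
        qed
        moreover have "snd w \<in> M" using valid_memory_reach[OF vw] * by blast
        ultimately have "\<psi> kap mu w" using securesD(4)[OF fZ] * w(2) by blast
        then obtain q where q: "(w, q) \<in> (step_rel G kap mu)\<^sup>*" "fst q \<in> Q" unfolding \<psi>_def by blast
        have "(t, q) \<in> (step_rel G kap mu)\<^sup>*" using w(1) q(1) by (rule rtrancl_trans)
        then have "node_colour G q \<le> c" using t(3) unfolding top_colour_def by blast
        then have "N \<le> c" using q(2) unfolding node_colour_def Q_def by simp
        moreover have "c \<le> N"
        proof -
          obtain u where "(t, u) \<in> (step_rel G kap mu)\<^sup>*" "node_colour G u = c"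
            using t(3) unfolding top_colour_def by blast
          moreover from this have "fst u \<in> G'" using stay rtrancl_trans[OF t(1)] by blast
          ultimately show ?thesis using col[of "fst u"] sub unfolding node_colour_def by auto
        qed
        ultimately show False using t(4) z x by auto
      next
        case False
        have inG'': "fst w \<in> G''" if "(t, w) \<in> (step_rel G kap mu)\<^sup>*" for w
          using False that stay[OF rtrancl_trans[OF t(1) that]] unfolding G''_def by blast
        have "follows G x G'' (G'' - V'') f2 kap mu t"
          unfolding follows_def
        proof (intro allI impI conjI; elim conjE)
          fix s m assume s: "(t, (s, m)) \<in> (step_rel G kap mu)\<^sup>*"
          then have vs: "(v, (s, m)) \<in> (step_rel G kap mu)\<^sup>*" using t(1) by (meson rtrancl_trans)
          have "s \<in> G''" using inG''[OF s] by simp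
          then show "kap s m = f2 s" if "s \<in> player_states G x"
            using * vs that sub unfolding follows_def f_def G''_def by auto
          show "kap s m \<in> G''" if "s \<in> player_states G (1 - x)"
            using inG''[OF rtrancl_into_rtrancl[OF s step_player]] player_not_random[OF _ that] by simp
        qed
        moreover have "fst t \<in> G'' - V''" using inG''[of t] V''0 by simp
        ultimately have "\<not> parity_possible G z kap mu t" using securesD(4)[OF f2 _ tM] * by blast
        then show False using t(2-4) unfolding parity_possible_def by blast
      qed
    qed
  qed
  then show ?thesis unfolding determined_def x_def G'_def V_def by blast
qed

text \<open>Where y := 1 - z cannot win with positive probability, z wins almost surely, so outside the
  region of z Player y wins with positive probability everywhere.\<close>
lemma determined_owner:
  assumes z: "z \<le> 1" and H: "subarena G H"
    and opp: "\<And>H'. subarena G H' \<Longrightarrow> H' \<subseteq> H \<Longrightarrow> determined (1 - z) H'"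
  shows "determined z H"
proof -
  define y where "y = 1 - z"
  have y: "y \<le> 1" "1 - y = z" using z unfolding y_def by auto
  define V where "V = region G (parity_possible G z) z H"
  define G' where "G' = H - V"
  note ev = eventual_parity_possible[of G]
  have G': "subarena G G'" unfolding G'_def V_def by (rule subarena_complement[OF z ev H])
  define V' where "V' = region G (parity_possible G y) y G'"
  obtain f1 where f1: "secures G (parity_possible G y) y G' V' f1"
    unfolding V'_def using region_secures[OF ev] by blast
  have sub: "V' \<subseteq> G'" "G' \<subseteq> H" using securesD(1)[OF f1] unfolding G'_def by auto
  obtain f2 where f2: "secures G (\<lambda>kap mu v. \<not> parity_possible G y kap mu v) z G' (G' - V') f2"
    using opp[OF G' sub(2)] y(2) unfolding determined_def V'_def y_def by auto
  have "G' - V' \<subseteq> region G (parity_possible G z) z H"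
  proof (rule region_extend[OF ev, where g = f2])
    show "G' - V' \<subseteq> H" using sub by blast
    show "(s, f2 s) \<in> E G \<and> f2 s \<in> H" if "s \<in> G' - V'" "s \<in> player_states G z" for s
      using securesD(2,3)[OF f2] that sub by blast
  next
    fix kap mu M v
    assume M: "valid_memory G kap mu M" "snd v \<in> M" and v: "fst v \<in> G' - V'"
      and never: "\<And>w. (v, w) \<in> (step_rel G kap mu)\<^sup>* \<Longrightarrow> fst w \<notin> region G (parity_possible G z) z H"
      and fol: "follows G z H (G' - V') f2 kap mu v"
    \<comment> \<open>\<open>never\<close> forbids moves into \<open>V\<close>, so an opponent who
      stays in \<open>H\<close> stays in \<open>G'\<close>, the arena in which \<open>f2\<close> is
      guaranteed to work.\<close>
    have "kap s m \<in> G'"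
      if s: "(v, (s, m)) \<in> (step_rel G kap mu)\<^sup>*" "s \<in> G' - V'" "s \<in> player_states G (1 - z)" for s m
    proof -
      have sR: "s \<notin> SR G" using s(3) player_not_random y unfolding y_def by blast
      have "(v, (kap s m, mu s m)) \<in> (step_rel G kap mu)\<^sup>*"
        using s(1) step_player[OF sR] by (rule rtrancl_into_rtrancl)
      from never[OF this] have "kap s m \<notin> V" unfolding V_def by simp
      moreover have "kap s m \<in> H" using fol s unfolding follows_def by blast
      ultimately show ?thesis unfolding G'_def by blast
    qed
    then have "follows G z G' (G' - V') f2 kap mu v" using fol unfolding follows_def by blast
    then have "\<not> parity_possible G y kap mu v" using securesD(4)[OF f2 M v] by blast
    then show "parity_possible G z kap mu v" using parity_possible_or[OF M z] unfolding y_def by blast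
  qed
  then have V': "V' = G'" using sub unfolding G'_def V_def by blast
  have "secures G (\<lambda>kap mu v. \<not> parity_possible G z kap mu v) y H G' f1"
    unfolding secures_def
  proof (intro conjI allI impI ballI)
    show "G' \<subseteq> H" by (rule sub)
    show "(s, f1 s) \<in> E G" "f1 s \<in> H" if "s \<in> G' \<inter> player_states G y" for s
      using securesD(2,3)[OF f1] that sub V' by auto
  next
    fix kap mu M v
    assume *: "valid_memory G kap mu M \<and> snd v \<in> M \<and> fst v \<in> G' \<and> follows G y H G' f1 kap mu v"
    have stay: "fst w \<in> G'" if "(v, w) \<in> (step_rel G kap mu)\<^sup>*" for w
      using complement_trap[OF z ev[of z] H, of G' kap mu M v f1 w] * that securesD(3)[OF f1] V'
      unfolding y_def G'_def V_def by blast
    have stay': "kap s m \<in> G'"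
      if "(v, (s, m)) \<in> (step_rel G kap mu)\<^sup>*" "s \<in> player_states G (1 - y)" for s m
      using stay[OF rtrancl_into_rtrancl[OF that(1) step_player]] player_not_random[OF _ that(2)] by simp
    have fol: "follows G y G' V' f1 kap mu v"
      using * stay' unfolding follows_def V' by blast
    \<comment> \<open>The play never leaves \<open>G' = V'\<close> and \<open>f1\<close> is
      positional, so its guarantee is renewed at every node reached.\<close>
    have "parity_possible G y kap mu w" if w: "(v, w) \<in> (step_rel G kap mu)\<^sup>*" for w
    proof (rule securesD(4)[OF f1])
      show "valid_memory G kap mu M" "snd w \<in> M" using * valid_memory_reach[OF w] by blast+
      show "fst w \<in> V'" using stay[OF w] V' by simp
      show "follows G y G' V' f1 kap mu w" by (rule follows_reach[OF fol w])
    qed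
    then show "\<not> parity_possible G z kap mu v"
      using parity_possible_everywhere[OF y(1)] y(2) by auto
  qed
  then show ?thesis unfolding determined_def y_def G'_def V_def by blast
qed

theorem determined_subarena:
  assumes "z \<le> 1" "subarena G H" "\<And>s. s \<in> H \<Longrightarrow> Col G s < N"
  shows "determined z H"
  using assms
proof (induction N arbitrary: z H)
  case 0
  then have "H = {}" by blast
  then show ?case unfolding determined_def secures_def by simp
next
  case (Suc N)
  \<comment> \<open>Stated for all \<open>z\<close> and \<open>H\<close>, because the owner case
    below applies it to the other player at the same bound \<open>Suc N\<close>, where the induction
    hypothesis does not reach.\<close>
  have non_owner: "determined z H" if "z \<le> 1" "z \<noteq> N mod 2" "subarena G H" "\<And>s. s \<in> H \<Longrightarrow> Col G s < Suc N" for z H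
  proof (rule determined_non_owner[OF that(1,2,3)])
    show "Col G s < Suc N" if "s \<in> H" for s by (rule \<open>\<And>s. s \<in> H \<Longrightarrow> Col G s < Suc N\<close>[OF that])
    show "determined z H" if "subarena G H" "\<And>s. s \<in> H \<Longrightarrow> Col G s < N" for H
      by (rule Suc.IH[OF \<open>z \<le> 1\<close> that])
  qed
  show ?case
  proof (cases "z = N mod 2")
    case True
    then have "1 - z \<noteq> N mod 2" using Suc.prems(1) by (cases z) auto
    show ?thesis
    proof (rule determined_owner[OF Suc.prems(1,2)])
      show "determined (1 - z) H'" if "subarena G H'" "H' \<subseteq> H" for H'
        using that Suc.prems(3) \<open>1 - z \<noteq> N mod 2\<close> by (intro non_owner) auto
    qed
  qed (use Suc.prems non_owner in auto)
qed

end

section \<open>Run measures of finite-memory plays\<close>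

lemma cyl_eq: "cyl p = {\<omega>. \<forall>i<length p. \<omega> !! i = p ! i}"
  unfolding cyl_def by (auto simp: list_eq_iff_nth_eq)

lemma cyl_sets: "cyl p \<in> sets (stream_space (count_space UNIV))"
proof -
  have [measurable]: "Measurable.pred (stream_space (count_space UNIV)) (\<lambda>\<omega>. \<omega> !! i = p ! i)" for i
    by (rule pred_snth)
  have "Measurable.pred (stream_space (count_space UNIV)) (\<lambda>\<omega>. \<forall>i<length p. \<omega> !! i = p ! i)"
    by measurable
  then show ?thesis by (simp add: cyl_eq pred_def space_stream_space)
qed

text \<open>On a possibly uncountable state space the cylinders do not generate the product algebra;
  they determine a measure that is concentrated on countably many states.\<close>
lemma cylinders_determine:
  fixes M N :: "'s stream measure"
  assumes S: "countable S" and ps: "prob_space M" "prob_space N"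
    and sets: "sets M = sets (stream_space (count_space UNIV))" "sets N = sets (stream_space (count_space UNIV))"
    and AE_N: "AE \<omega> in N. \<omega> \<in> streams S"
    and cyl: "\<And>p. emeasure M (cyl p) = emeasure N (cyl p)"
  shows "M = N"
proof -
  have AE_k: "AE \<omega> in M. \<omega> !! k \<in> S" for k
  proof -
    \<comment> \<open>There are only countably many prefixes over \<open>S\<close>, so staying in
      \<open>S\<close> up to time \<open>k\<close> is a countable disjoint union of cylinders and
      has equal measure under \<open>M\<close> and \<open>N\<close>.\<close>
    define L where "L = {p \<in> lists S. length p = Suc k}"
    have "L \<subseteq> lists S" unfolding L_def by (rule Collect_restrict)
    then have L: "countable L" using countable_lists[OF S] by (rule countable_subset)
    have U: "emeasure P (\<Union>p\<in>L. cyl p) = (\<integral>\<^sup>+p. emeasure P (cyl p) \<partial>count_space L)"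
      if "sets P = sets (stream_space (count_space UNIV))" for P :: "'s stream measure"
    proof (rule emeasure_UN_countable[OF _ L])
      show "cyl p \<in> sets P" for p using cyl_sets that by simp
      show "disjoint_family_on cyl L" unfolding disjoint_family_on_def cyl_def L_def by auto
    qed
    have Ueq: "(\<Union>p\<in>L. cyl p) = {\<omega>. \<forall>i\<le>k. \<omega> !! i \<in> S}"
    proof (intro equalityI subsetI)
      fix \<omega> assume "\<omega> \<in> (\<Union>p\<in>L. cyl p)"
      then obtain p where p: "set p \<subseteq> S" "length p = Suc k" "\<omega> \<in> cyl p" unfolding L_def by auto
      then have "\<omega> !! i \<in> S" if "i \<le> k" for i
        using that nth_mem[of i p] unfolding cyl_eq by auto
      then show "\<omega> \<in> {\<omega>. \<forall>i\<le>k. \<omega> !! i \<in> S}" by simp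
    next
      fix \<omega> assume "\<omega> \<in> {\<omega>. \<forall>i\<le>k. \<omega> !! i \<in> S}"
      then have "stake (Suc k) \<omega> \<in> L"
        unfolding L_def by (auto simp: in_set_conv_nth simp del: stake.simps)
      moreover have "\<omega> \<in> cyl (stake (Suc k) \<omega>)" unfolding cyl_def by (simp del: stake.simps)
      ultimately show "\<omega> \<in> (\<Union>p\<in>L. cyl p)" by blast
    qed
    have "AE \<omega> in N. \<omega> \<in> (\<Union>p\<in>L. cyl p)"
      using AE_N unfolding Ueq by (rule eventually_mono) (auto intro: snth_in)
    moreover have "(\<Union>p\<in>L. cyl p) \<in> sets N"
      using cyl_sets L by (intro sets.countable_UN') (auto simp: sets(2))
    ultimately have "emeasure N (\<Union>p\<in>L. cyl p) = 1"
      by (intro prob_space.emeasure_eq_1_AE[OF ps(2)])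
    then have 1: "emeasure M (\<Union>p\<in>L. cyl p) = 1" using U[OF sets(1)] U[OF sets(2)] cyl by simp
    interpret M: prob_space M by (rule ps)
    have "(\<Union>p\<in>L. cyl p) \<in> sets M"
      using cyl_sets L by (intro sets.countable_UN') (auto simp: sets(1))
    then have "AE \<omega> in M. \<omega> \<in> (\<Union>p\<in>L. cyl p)"
      using 1 by (subst M.AE_in_set_eq_1) (simp_all add: M.emeasure_eq_measure)
    then show ?thesis unfolding Ueq by (rule eventually_mono) auto
  qed
  have AE_M: "AE \<omega> in M. \<omega> \<in> streams S"
    using AE_k by (simp add: streams_iff_snth AE_all_countable)
  show ?thesis
  proof (rule stream_space_eq_sstart[OF S ps AE_M AE_N sets])
    fix xs :: "'s list"
    \<comment> \<open>On streams over \<open>S\<close>, the generator \<open>sstart S xs\<close> and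
      the cylinder of \<open>xs\<close> coincide.\<close>
    have "emeasure P (sstart S xs) = emeasure P (cyl xs)"
      if "sets P = sets (stream_space (count_space UNIV))" "AE \<omega> in P. \<omega> \<in> streams S"
        "xs \<in> lists S" for P :: "'s stream measure"
      using that(2) cyl_sets sstart_sets that(1,3)
      by (intro emeasure_eq_AE) (auto elim!: eventually_mono simp: sstart_eq cyl_eq)
    then show "emeasure M (sstart S xs) = emeasure N (sstart S xs)" if "xs \<in> lists S"
      using AE_M AE_N sets cyl that by simp
  qed
qed

section \<open>The play as a chain and its path weights\<close>

text \<open>The memory is updated with the state being left, which matches \<open>mu_path\<close> on
  \<open>butlast\<close> in the definition of finite-memory strategies.\<close>

definition node_kernel ::
    "'s game \<Rightarrow> ('s \<Rightarrow> nat \<Rightarrow> 's) \<Rightarrow> ('s \<Rightarrow> nat \<Rightarrow> nat) \<Rightarrow> 's \<times> nat \<Rightarrow> ('s \<times> nat) pmf" where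
  "node_kernel G kap mu v =
     (if fst v \<in> SR G then map_pmf (\<lambda>t. (t, mu (fst v) (snd v))) (embed_pmf (Prob G (fst v)))
      else return_pmf (kap (fst v) (snd v), mu (fst v) (snd v)))"

definition node_prob :: "'s game \<Rightarrow> ('s \<Rightarrow> nat \<Rightarrow> 's) \<Rightarrow> 's \<Rightarrow> nat \<Rightarrow> 's \<Rightarrow> real" where
  "node_prob G kap s m t = (if s \<in> SR G then Prob G s t else if t = kap s m then 1 else 0)"

fun path_weight ::
    "'s game \<Rightarrow> ('s \<Rightarrow> nat \<Rightarrow> 's) \<Rightarrow> ('s \<Rightarrow> nat \<Rightarrow> nat) \<Rightarrow> nat \<Rightarrow> 's list \<Rightarrow> real" where
  "path_weight G kap mu m (a # b # p) = node_prob G kap a m b * path_weight G kap mu (mu a m) (b # p)"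
| "path_weight G kap mu m p = 1"

text \<open>The recursive form fits the one-step equation of the chain, the product form fits
  \<open>cyl_prob\<close>.\<close>

lemma path_weight_prod:
  "path_weight G kap mu m p =
     (\<Prod>i<length p - 1. node_prob G kap (p ! i) (mu_path mu (take i p) m) (p ! Suc i))"
proof (induction G kap mu m p rule: path_weight.induct)
  case (1 G kap mu m a b p)
  then show ?case by (simp add: prod.lessThan_Suc_shift mu_path_def del: prod.lessThan_Suc)
qed simp_all

definition conforms ::
    "'s game \<Rightarrow> ('s \<Rightarrow> nat \<Rightarrow> 's) \<Rightarrow> ('s \<Rightarrow> nat \<Rightarrow> nat) \<Rightarrow> nat \<Rightarrow> nat \<Rightarrow> ('s list \<Rightarrow> 's option) \<Rightarrow> bool" where
  "conforms G kap mu m y f \<longleftrightarrow> (\<forall>p. is_path G p \<and> last p \<in> player_states G y \<longrightarrow>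
     f p = Some (kap (last p) (mu_path mu (butlast p) m)))"

lemma mu_path_in:
  assumes "valid_memory G kap mu M" "m \<in> M" shows "mu_path mu p m \<in> M"
proof -
  have "foldl (\<lambda>m' s. mu s m') m p \<in> M"
    using assms by (induction p arbitrary: m) (auto simp: valid_memory_def)
  then show ?thesis by (simp add: mu_path_def)
qed

context arena
begin

lemma Prob_nn_integral:
  assumes "s \<in> SR G" shows "(\<integral>\<^sup>+ t. ennreal (Prob G s t) \<partial>count_space UNIV) = 1"
proof -
  have nonneg: "\<And>t. 0 \<le> Prob G s t" and has: "(Prob G s has_sum 1) UNIV"
    using game assms unfolding is_game_def by auto
  have abs: "Infinite_Set_Sum.abs_summable_on (Prob G s) UNIV"
    using has nonneg by (subst abs_summable_equivalent[symmetric]) (auto simp: summable_on_def)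
  have "(\<integral>\<^sup>+ t. ennreal (Prob G s t) \<partial>count_space UNIV) = ennreal (infsetsum (Prob G s) UNIV)"
    by (rule nn_integral_conv_infsetsum[OF abs nonneg])
  also have "infsetsum (Prob G s) UNIV = 1"
    using infsetsum_infsum[OF abs] has by (simp add: infsumI)
  finally show ?thesis by simp
qed

lemma Prob_eq_0_iff: "s \<in> SR G \<Longrightarrow> Prob G s t = 0 \<longleftrightarrow> (s, t) \<notin> E G"
  using game unfolding is_game_def by (metis less_eq_real_def less_irrefl)

lemma Prob_nonneg: "s \<in> SR G \<Longrightarrow> 0 \<le> Prob G s t"
  using game unfolding is_game_def by blast

lemma node_prob_nonneg: "0 \<le> node_prob G kap s m t"
  unfolding node_prob_def using Prob_nonneg by simp

lemma path_weight_nonneg: "0 \<le> path_weight G kap mu m p"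
  unfolding path_weight_prod by (intro prod_nonneg ballI node_prob_nonneg)

lemma pmf_Prob: "s \<in> SR G \<Longrightarrow> pmf (embed_pmf (Prob G s)) t = Prob G s t"
  by (intro pmf_embed_pmf Prob_nonneg Prob_nn_integral)

text \<open>Random moves have positive probability exactly along edges, so the support graph of the
  chain is the graph of the combinatorial part.\<close>

lemma chain_rel_node_kernel: "chain_rel (node_kernel G kap mu) = step_rel G kap mu"
proof -
  have "set_pmf (embed_pmf (Prob G s)) = {t. (s, t) \<in> E G}" if "s \<in> SR G" for s
    using that by (auto simp: set_pmf_eq pmf_Prob Prob_eq_0_iff)
  then show ?thesis
    unfolding chain_rel_def step_rel_def node_kernel_def by (auto split: if_splits)
qed

definition reachable :: "('s \<Rightarrow> nat \<Rightarrow> 's) \<Rightarrow> ('s \<Rightarrow> nat \<Rightarrow> nat) \<Rightarrow> 's \<times> nat \<Rightarrow> ('s \<times> nat) set" where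
  "reachable kap mu v = {w. (v, w) \<in> (step_rel G kap mu)\<^sup>*}"

lemma markov_chain_reachable: "markov_chain (node_kernel G kap mu) (reachable kap mu v)"
proof
  have "countable (step_rel G kap mu `` Y)" if "countable Y" for Y
  proof -
    have "countable (step_rel G kap mu `` {(s, m)})" for s m
    proof -
      have "step_rel G kap mu `` {(s, m)} \<subseteq> (\<lambda>t. (t, mu s m)) ` (insert (kap s m) {t. (s, t) \<in> E G})"
        unfolding step_rel_def by (auto split: if_splits)
      moreover have "countable {t. (s, t) \<in> E G}" using game unfolding is_game_def by blast
      ultimately show ?thesis by (meson countable_image countable_insert countable_subset)
    qed
    then have "countable (\<Union>v\<in>Y. step_rel G kap mu `` {v})" using that by auto
    then show ?thesis by (simp add: Image_eq_UN[of _ Y, symmetric])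
  qed
  then have "countable ((step_rel G kap mu)\<^sup>* `` {v})" by (intro countable_rtrancl) auto
  moreover have "reachable kap mu v = (step_rel G kap mu)\<^sup>* `` {v}" unfolding reachable_def by auto
  ultimately show "countable (reachable kap mu v)" by simp
  show "set_pmf (node_kernel G kap mu w) \<subseteq> reachable kap mu v" if "w \<in> reachable kap mu v" for w
  proof
    fix w' assume "w' \<in> set_pmf (node_kernel G kap mu w)"
    then have "(w, w') \<in> step_rel G kap mu" unfolding chain_rel_node_kernel[symmetric] chain_rel_def by simp
    then show "w' \<in> reachable kap mu v"
      using that unfolding reachable_def by (auto intro: rtrancl_into_rtrancl)
  qed
qed

end

locale play = arena G n for G :: "'s game" and n +
  fixes kap :: "'s \<Rightarrow> nat \<Rightarrow> 's" and mu :: "'s \<Rightarrow> nat \<Rightarrow> nat" and M :: "nat set" and C :: "('s \<times> nat) set"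
  assumes memory: "valid_memory G kap mu M"
    and chain: "markov_chain (node_kernel G kap mu) C"
begin

sublocale markov_chain "node_kernel G kap mu" C by (rule chain)

definition state_measure :: "'s \<times> nat \<Rightarrow> 's stream measure" where
  "state_measure v = distr (T v) (stream_space (count_space UNIV)) (smap fst)"

lemma measurable_smap_fst [measurable]:
  "smap fst \<in> measurable (T v) (stream_space (count_space UNIV))"
  unfolding measurable_cong_sets[OF sets_T refl] by measurable

text \<open>Each step of the induction peels off the first state with \<open>emeasure_T\<close>; the
  start memory varies because the rest of the path is weighed with the updated value.\<close>

lemma emeasure_state_measure_cyl:
  assumes "(s, m) \<in> C"
  shows "emeasure (state_measure (s, m)) (cyl p) =
    ennreal (if p = [] then 1 else if hd p \<noteq> s then 0 else path_weight G kap mu m p)"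
  using assms
proof (induction p arbitrary: s m)
  case Nil
  have "prob_space (state_measure (s, m))"
    unfolding state_measure_def by (intro prob_space.prob_space_distr prob_space_T Nil measurable_smap_fst)
  then show ?case
    using prob_space.emeasure_space_1 by (fastforce simp: cyl_def state_measure_def space_stream_space)
next
  case (Cons a p)
  have sm: "emeasure (state_measure w) (cyl q) = emeasure (T w) {\<omega>. smap fst \<omega> \<in> cyl q}" for w q
    unfolding state_measure_def
    by (subst emeasure_distr[OF measurable_smap_fst cyl_sets]) (simp add: vimage_def)
  have pred: "Measurable.pred SS (\<lambda>\<omega>. smap fst \<omega> \<in> cyl q)" for q :: "'s list"
    using measurable_sets[OF measurable_smap_fst cyl_sets[of q], of undefined]
    by (simp add: vimage_def pred_def space_stream_space)
  have step: "emeasure (state_measure (s, m)) (cyl (a # p)) =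
      (if s = a then \<integral>\<^sup>+ w. emeasure (state_measure w) (cyl p) \<partial>node_kernel G kap mu (s, m) else 0)"
    unfolding sm by (subst emeasure_T[OF Cons.prems pred]) (simp add: cyl_def)
  show ?case
  proof (cases "s = a")
    case False then show ?thesis by (simp add: step)
  next
    case True
    have "(\<integral>\<^sup>+ w. emeasure (state_measure w) (cyl p) \<partial>node_kernel G kap mu (s, m)) =
      (\<integral>\<^sup>+ w. ennreal (if p = [] then 1 else if hd p \<noteq> fst w then 0 else path_weight G kap mu (snd w) p)
        \<partial>node_kernel G kap mu (s, m))"
      using Cons.IH closed_C[OF Cons.prems] by (intro nn_integral_cong_AE) (auto simp: AE_measure_pmf_iff)
    also have "\<dots> = ennreal (path_weight G kap mu m (a # p))"
    proof (cases p)
      case Nil then show ?thesis by (simp add: measure_pmf.emeasure_space_1[simplified])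
    next
      case (Cons b q)
      define c where "c = path_weight G kap mu (mu s m) p"
      have c: "0 \<le> c" unfolding c_def by (rule path_weight_nonneg)
      have "(\<integral>\<^sup>+ w. ennreal (if p = [] then 1 else if hd p \<noteq> fst w then 0 else path_weight G kap mu (snd w) p)
          \<partial>node_kernel G kap mu (s, m)) = ennreal (node_prob G kap s m b) * ennreal c"
      proof (cases "s \<in> SR G")
        case sR: True
        have "(\<integral>\<^sup>+ w. ennreal (if p = [] then 1 else if hd p \<noteq> fst w then 0 else path_weight G kap mu (snd w) p)
            \<partial>node_kernel G kap mu (s, m)) =
            (\<integral>\<^sup>+ t. ennreal (if p = [] then 1 else if hd p \<noteq> fst (t, mu s m) then 0
               else path_weight G kap mu (snd (t, mu s m)) p) \<partial>embed_pmf (Prob G s))"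
          using sR unfolding node_kernel_def fst_conv snd_conv if_P[OF sR] nn_integral_map_pmf by simp
        also have "\<dots> = (\<integral>\<^sup>+ t. ennreal c * indicator {b} t \<partial>embed_pmf (Prob G s))"
          using Cons unfolding c_def by (intro nn_integral_cong) (auto split: split_indicator)
        also have "\<dots> = ennreal c * emeasure (embed_pmf (Prob G s)) {b}"
          by (subst nn_integral_cmult_indicator) auto
        also have "\<dots> = ennreal (node_prob G kap s m b) * ennreal c"
          using sR by (simp add: emeasure_pmf_single pmf_Prob node_prob_def mult.commute)
        finally show ?thesis .
      next
        case False
        then show ?thesis
          using Cons unfolding node_kernel_def c_def node_prob_def by (auto simp: nn_integral_return)
      qed
      also have "\<dots> = ennreal (path_weight G kap mu m (a # p))"
        using True Cons c node_prob_nonneg unfolding c_def by (simp flip: ennreal_mult)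
      finally show ?thesis .
    qed
    finally show ?thesis unfolding step using True by simp
  qed
qed

lemma step_prob_eq:
  assumes strat: "conforms G kap mu m 0 f0" "conforms G kap mu m 1 f1"
    and p: "is_path G p" "Suc i < length p"
  shows "step_prob G f0 f1 (take (Suc i) p) (p ! Suc i) =
    node_prob G kap (p ! i) (mu_path mu (take i p) m) (p ! Suc i)"
proof -
  have take: "take (Suc i) p = take i p @ [p ! i]"
    using p(2) by (simp add: take_Suc_conv_app_nth)
  have path: "is_path G (take (Suc i) p)" using p unfolding is_path_def by auto
  have *: "f (take (Suc i) p) = Some (kap (p ! i) (mu_path mu (take i p) m))"
    if "conforms G kap mu m y f" "p ! i \<in> player_states G y" for y f
    using that path unfolding conforms_def take by auto
  have "f0 (take (Suc i) p) = Some (kap (p ! i) (mu_path mu (take i p) m))" if "p ! i \<in> S0 G"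
    using *[OF strat(1)] that by (simp add: player_states_def)
  moreover have "f1 (take (Suc i) p) = Some (kap (p ! i) (mu_path mu (take i p) m))" if "p ! i \<in> S1 G"
    using *[OF strat(2)] that by (simp add: player_states_def)
  moreover have "last (take (Suc i) p) = p ! i" by (simp add: take)
  moreover have "p ! i \<in> SR G \<longleftrightarrow> p ! i \<notin> S0 G \<and> p ! i \<notin> S1 G"
    using game unfolding is_game_def by auto
  ultimately show ?thesis unfolding step_prob_def node_prob_def by auto
qed

text \<open>\<open>conforms\<close> determines the strategies on genuine paths only. A list with a
  non-edge is treated separately: both products then contain a zero factor.\<close>

lemma cyl_prob_eq:
  assumes strat: "conforms G kap mu m 0 f0" "conforms G kap mu m 1 f1"
    and total: "total_strategy G 0 f0" "total_strategy G 1 f1" and m: "m \<in> M"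
  shows "cyl_prob G s f0 f1 p = (if p = [] then 1 else if hd p \<noteq> s then 0 else path_weight G kap mu m p)"
proof -
  have "(\<Prod>i<length p - 1. step_prob G f0 f1 (take (Suc i) p) (p ! Suc i)) = path_weight G kap mu m p"
    if "p \<noteq> []"
  proof (cases "is_path G p")
    case True
    then show ?thesis
      unfolding path_weight_prod by (intro prod.cong refl step_prob_eq strat) auto
  next
    case False
    then obtain i where i: "Suc i < length p" "(p ! i, p ! Suc i) \<notin> E G"
      using \<open>p \<noteq> []\<close> unfolding is_path_def by blast
    have last: "last (take (Suc i) p) = p ! i"
      using i(1) by (simp add: take_Suc_conv_app_nth)
    have "f0 (take (Suc i) p) \<noteq> Some (p ! Suc i)" "f1 (take (Suc i) p) \<noteq> Some (p ! Suc i)"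
      using total i(2) last unfolding total_strategy_def strategy_def by metis+
    moreover have "Prob G (p ! i) (p ! Suc i) = 0" if "p ! i \<in> SR G"
      using Prob_eq_0_iff[OF that] i(2) by simp
    moreover have R: "p ! i \<in> SR G \<longleftrightarrow> p ! i \<notin> S0 G \<and> p ! i \<notin> S1 G"
      using game unfolding is_game_def by auto
    ultimately have 1: "step_prob G f0 f1 (take (Suc i) p) (p ! Suc i) = 0"
      unfolding step_prob_def last by auto
    have "(p ! i, kap (p ! i) (mu_path mu (take i p) m)) \<in> E G" if "p ! i \<notin> SR G"
      using memory mu_path_in[OF memory m] that unfolding valid_memory_def by blast
    then have 2: "node_prob G kap (p ! i) (mu_path mu (take i p) m) (p ! Suc i) = 0"
      using i(2) Prob_eq_0_iff unfolding node_prob_def by metis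
    have "i < length p - 1" using i(1) by simp
    then have i': "i \<in> {..<length p - 1}" by simp
    have "(\<Prod>i<length p - 1. step_prob G f0 f1 (take (Suc i) p) (p ! Suc i)) = 0"
      by (rule prod_zero[OF _ bexI[where x = i]]) (use 1 i' in simp_all)
    moreover have "path_weight G kap mu m p = 0"
      unfolding path_weight_prod by (rule prod_zero[OF _ bexI[where x = i]]) (use 2 i' in simp_all)
    ultimately show ?thesis by simp
  qed
  then show ?thesis unfolding cyl_prob_def by simp
qed

lemma run_measure_eq:
  assumes v: "(s, m) \<in> C" and m: "m \<in> M"
    and strat: "conforms G kap mu m 0 f0" "conforms G kap mu m 1 f1"
    and total: "total_strategy G 0 f0" "total_strategy G 1 f1"
  shows "run_measure G s f0 f1 = state_measure (s, m)"
proof -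
  have ps: "prob_space (state_measure (s, m))"
    unfolding state_measure_def by (intro prob_space.prob_space_distr prob_space_T v measurable_smap_fst)
  have sets: "sets (state_measure (s, m)) = sets (stream_space (count_space UNIV))"
    unfolding state_measure_def by simp
  have cyl: "emeasure (state_measure (s, m)) (cyl p) = ennreal (cyl_prob G s f0 f1 p)" for p
    unfolding emeasure_state_measure_cyl[OF v] cyl_prob_eq[OF strat total m] ..
  have "AE \<omega> in T (s, m). smap fst \<omega> \<in> streams (fst ` C)"
    using AE_reach[OF v] by (rule eventually_mono) (use reach_C[OF _ v] in \<open>auto simp: streams_iff_snth\<close>)
  then have AE: "AE \<omega> in state_measure (s, m). \<omega> \<in> streams (fst ` C)"
    unfolding state_measure_def using streams_sets[of "fst ` C" "count_space UNIV"]
    by (subst AE_distr_iff) (auto simp: space_stream_space)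
  show ?thesis
    unfolding run_measure_def
  proof (rule the_equality)
    fix N :: "'s stream measure"
    assume N: "sets N = sets (stream_space (count_space UNIV)) \<and> prob_space N \<and>
      (\<forall>p. emeasure N (cyl p) = ennreal (cyl_prob G s f0 f1 p))"
    show "N = state_measure (s, m)"
      using N cyl by (intro cylinders_determine[OF _ _ ps _ sets AE]) (auto intro: countable_C)
  qed (use ps sets cyl in auto)
qed

lemma parity_smap: "smap fst \<omega> \<in> parity G z \<longleftrightarrow> stream_parity (node_colour G) z \<omega>"
  unfolding parity_def stream_parity_def node_colour_def by simp

lemma parity_sets: "parity G z \<in> sets (stream_space (count_space UNIV))"
  using pred_stream_parity[of "Col G" z]
  by (simp add: pred_def space_stream_space parity_def stream_parity_def[abs_def])

lemma measure_parity_eq_1: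
  assumes "v \<in> C" "AE \<omega> in T v. stream_parity (node_colour G) z \<omega>"
  shows "measure (state_measure v) (parity G z) = 1"
proof -
  have "prob_space (state_measure v)"
    unfolding state_measure_def by (intro prob_space.prob_space_distr prob_space_T assms(1) measurable_smap_fst)
  moreover have "AE \<omega> in state_measure v. \<omega> \<in> parity G z"
    unfolding state_measure_def using assms(2) parity_sets
    by (subst AE_distr_iff) (auto simp: parity_smap space_stream_space)
  ultimately show ?thesis
    using parity_sets by (intro prob_space.prob_eq_1[THEN iffD2]) (auto simp: state_measure_def)
qed

lemma measure_parity_pos:
  assumes "v \<in> C" "\<not> (AE \<omega> in T v. \<not> stream_parity (node_colour G) z \<omega>)"
  shows "0 < measure (state_measure v) (parity G z)"
proof -
  have "prob_space (state_measure v)"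
    unfolding state_measure_def by (intro prob_space.prob_space_distr prob_space_T assms(1) measurable_smap_fst)
  then interpret prob_space "state_measure v" .
  have "{\<omega>. \<omega> \<notin> parity G z} \<in> sets (stream_space (count_space UNIV))"
    using sets.compl_sets[OF parity_sets[of z]] by (simp add: space_stream_space set_diff_eq)
  then have "\<not> (AE \<omega> in state_measure v. \<omega> \<notin> parity G z)"
    unfolding state_measure_def using assms(2) parity_sets
    by (subst AE_distr_iff) (auto simp: parity_smap space_stream_space)
  then have "measure (state_measure v) (parity G z) \<noteq> 0"
    using parity_sets by (subst prob_eq_0) (auto simp: state_measure_def)
  then show ?thesis using measure_nonneg by (metis less_eq_real_def)
qed

end

section \<open>From strategies to plays\<close>

context arena
begin

definition positional :: "nat \<Rightarrow> ('s \<Rightarrow> 's) \<Rightarrow> 's list \<Rightarrow> 's option" where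
  "positional y \<phi> p = (if is_path G p \<and> last p \<in> player_states G y then Some (\<phi> (last p)) else None)"

definition legal :: "nat \<Rightarrow> ('s \<Rightarrow> 's) \<Rightarrow> bool" where
  "legal y \<phi> \<longleftrightarrow> (\<forall>s\<in>player_states G y. (s, \<phi> s) \<in> E G)"

lemma memoryless_positional: "legal y \<phi> \<Longrightarrow> positional y \<phi> \<in> memoryless_strategies G y"
  unfolding memoryless_strategies_def memoryless_def strategy_def positional_def legal_def by auto

text \<open>\<open>secures\<close> promises legal moves only inside \<open>V\<close>; elsewhere any
  successor completes the strategy.\<close>

lemma ex_legal:
  obtains \<phi> where "legal y \<phi>" "\<And>s. s \<in> V \<Longrightarrow> s \<in> player_states G y \<Longrightarrow> (s, f s) \<in> E G \<Longrightarrow> \<phi> s = f s"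
proof -
  define \<phi> where "\<phi> = (\<lambda>s. if (s, f s) \<in> E G then f s else SOME t. (s, t) \<in> E G)"
  have "(s, SOME t. (s, t) \<in> E G) \<in> E G" for s
    using game someI_ex[of "\<lambda>t. (s, t) \<in> E G"] unfolding is_game_def by blast
  then have "legal y \<phi>" unfolding legal_def \<phi>_def by auto
  then show thesis by (rule that) (simp add: \<phi>_def)
qed

text \<open>\<open>positional\<close> is already defined on every path it has to serve, so an
  extension cannot change it there.\<close>

lemma total_extends_conforms:
  assumes "total_strategy G y h" "extends h (positional y \<phi>)"
    and "\<And>s m. s \<in> player_states G y \<Longrightarrow> kap s m = \<phi> s"
  shows "conforms G kap mu m y h"
  using assms unfolding conforms_def extends_def positional_def by (metis option.distinct(1))

text \<open>The positional player needs no memory, so the memory of the opponent serves for the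
  whole play.\<close>

lemma finite_memory_play:
  assumes y: "y \<le> 1" and \<phi>: "legal y \<phi>" and g: "g \<in> finite_memory_strategies G (1 - y)"
  obtains kap mu M m where "valid_memory G kap mu M" "m \<in> M"
    "\<And>s m. s \<in> player_states G y \<Longrightarrow> kap s m = \<phi> s" "conforms G kap mu m (1 - y) g"
proof -
  have "finite_memory G (1 - y) g" using g by (simp add: finite_memory_strategies_def)
  then obtain M :: "nat set" and m0 tau mu where fm_all: "finite M \<and> m0 \<in> M \<and> (\<forall>s. \<forall>m\<in>M. mu s m \<in> M) \<and>
      (\<forall>s\<in>player_states G (1 - y). \<forall>m\<in>M. (s, tau s m) \<in> E G) \<and>
      (\<forall>p. is_path G p \<and> last p \<in> player_states G (1 - y) \<longrightarrow>
        g p = Some (tau (last p) (mu_path mu (butlast p) m0)))"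
    unfolding finite_memory_def by (elim conjE exE) (rule that, intro conjI; assumption)
  then have fm: "finite M" "m0 \<in> M" "\<forall>s. \<forall>m\<in>M. mu s m \<in> M"
      "\<forall>s\<in>player_states G (1 - y). \<forall>m\<in>M. (s, tau s m) \<in> E G"
    and g_eq: "\<forall>p. is_path G p \<and> last p \<in> player_states G (1 - y) \<longrightarrow>
      g p = Some (tau (last p) (mu_path mu (butlast p) m0))"
    by blast+
  define kap where "kap = (\<lambda>s m. if s \<in> player_states G y then \<phi> s else tau s m)"
  show thesis
  proof (rule that)
    have "(s, kap s m) \<in> E G" if "s \<notin> SR G" "m \<in> M" for s m
      using that fm(4) \<phi> unfolding kap_def legal_def by (cases rule: state_cases[OF y, of s]) auto
    then show "valid_memory G kap mu M" unfolding valid_memory_def using fm(1,3) by blast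
    show "m0 \<in> M" by (rule fm(2))
    show "kap s m = \<phi> s" if "s \<in> player_states G y" for s m using that by (simp add: kap_def)
    have "s \<notin> player_states G y" if "s \<in> player_states G (1 - y)" for s
      using that state_cases[OF y, of s] by blast
    then show "conforms G kap mu m0 (1 - y) g" unfolding conforms_def kap_def using g_eq by simp
  qed
qed

text \<open>\<open>attractor\<close> speaks of pairs of strategies started at a state. Any memory
  value in \<open>M\<close> may serve as the initial one, so the property transfers to every node,
  including those met in the middle of a play.\<close>

lemma attractor_AE_hit:
  assumes att: "attractor G A" and M: "valid_memory G kap mu M" "snd v \<in> M"
    and C: "markov_chain (node_kernel G kap mu) C" "v \<in> C"
  shows "AE \<omega> in chain_measure (node_kernel G kap mu) C v. \<exists>i. \<omega> !! i \<in> A \<times> M"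
proof -
  obtain s m where v: "v = (s, m)" by (cases v)
  interpret play G n kap mu M C by (intro play.intro play_axioms.intro arena_axioms M C)
  \<comment> \<open>The two strategies that generate the given play from initial memory
    \<open>m\<close>.\<close>
  define st where "st = (\<lambda>y p. if is_path G p \<and> last p \<in> player_states G y
    then Some (kap (last p) (mu_path mu (butlast p) m)) else None)"
  have total: "total_strategy G y (st y)" if "y \<le> 1" for y
  proof -
    have "(t, kap t (mu_path mu p m)) \<in> E G" if "t \<in> player_states G y" for t p
      using mu_path_in[OF M(1)] M v that player_not_random[OF \<open>y \<le> 1\<close>] unfolding valid_memory_def by auto
    then show ?thesis unfolding total_strategy_def strategy_def st_def by auto
  qed
  have conf: "conforms G kap mu m y (st y)" for y unfolding conforms_def st_def by simp
  have "measure (run_measure G s (st 0) (st 1)) {\<omega>. \<exists>i. \<omega> !! i \<in> A} = 1"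
    using att total[of 0] total[of 1] unfolding attractor_def by simp
  moreover have "run_measure G s (st 0) (st 1) = state_measure (s, m)"
    using C M v total[of 0] total[of 1] conf by (intro run_measure_eq) auto
  ultimately have 1: "measure (state_measure v) {\<omega>. \<exists>i. \<omega> !! i \<in> A} = 1" using v by simp
  have [measurable]: "Measurable.pred (stream_space (count_space UNIV)) (\<lambda>\<omega>. \<omega> !! i \<in> A)" for i
    by (rule pred_snth)
  have "Measurable.pred (stream_space (count_space UNIV)) (\<lambda>\<omega>. \<exists>i. \<omega> !! i \<in> A)" by measurable
  then have sets: "{\<omega>. \<exists>i. \<omega> !! i \<in> A} \<in> sets (stream_space (count_space UNIV))"
    by (simp add: pred_def space_stream_space)
  have "prob_space (state_measure v)"
    unfolding state_measure_def by (intro prob_space.prob_space_distr prob_space_T C measurable_smap_fst)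
  then have "AE \<omega> in state_measure v. \<omega> \<in> {\<omega>. \<exists>i. \<omega> !! i \<in> A}"
    using 1 sets by (subst prob_space.AE_in_set_eq_1) (auto simp: state_measure_def)
  then have "AE \<omega> in T v. \<exists>i. smap fst \<omega> !! i \<in> A"
    unfolding state_measure_def using sets by (subst (asm) AE_distr_iff) (auto simp: space_stream_space)
  moreover have "AE \<omega> in T v. \<forall>i. (v, \<omega> !! i) \<in> (chain_rel (node_kernel G kap mu))\<^sup>*"
    by (rule AE_reach[OF C(2)])
  ultimately show ?thesis
  proof (eventually_elim)
    case (elim \<omega>)
    then obtain i where "fst (\<omega> !! i) \<in> A" by auto
    moreover have "snd (\<omega> !! i) \<in> M"
      using elim(2) valid_memory_reach[OF _ M] unfolding chain_rel_node_kernel by blast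
    ultimately show ?case by (intro exI[of _ i]) (simp add: mem_Times_iff)
  qed
qed

lemma self_reachable: "v \<in> reachable kap mu v"
  unfolding reachable_def by simp

lemma finite_attractor_arenaI:
  assumes "attractor G A" "finite A" shows "finite_attractor_arena G n A"
proof
  fix kap mu M and v :: "'s \<times> nat"
  assume M: "valid_memory G kap mu M" "snd v \<in> M"
  interpret markov_chain "node_kernel G kap mu" "reachable kap mu v" by (rule markov_chain_reachable)
  have "\<exists>a\<in>A \<times> M. (v, a) \<in> (chain_rel (node_kernel G kap mu))\<^sup>*"
    using self_reachable attractor_AE_hit[OF assms(1) M] markov_chain_axioms by (intro AE_hit_reach) auto
  then show "\<exists>w. (v, w) \<in> (step_rel G kap mu)\<^sup>* \<and> fst w \<in> A"
    unfolding chain_rel_node_kernel by auto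
qed (rule assms)

end

locale attracted_arena = arena G n for G :: "'s game" and n +
  fixes A :: "'s set"
  assumes att: "attractor G A" and fin: "finite A"
begin

sublocale finite_attractor_arena G n A by (rule finite_attractor_arenaI[OF att fin])

text \<open>The way back from graphs to probabilities, for an arbitrary total extension
  \<open>h\<close> of the positional strategy. Both implications concern the same play, so the lemma
  serves the almost-sure and the positive-probability player alike.\<close>

lemma parity_probability:
  assumes y: "y \<le> 1" and \<phi>: "legal y \<phi>" and g: "g \<in> finite_memory_strategies G (1 - y)"
    and h: "total_strategy G y h" "extends h (positional y \<phi>)"
  obtains kap mu M m where "valid_memory G kap mu M" "m \<in> M"
    "\<forall>s\<in>player_states G y. \<forall>m. kap s m = \<phi> s"
    "z \<le> 1 \<and> \<not> parity_possible G (1 - z) kap mu (s, m) \<longrightarrow>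
      measure (if y = 0 then run_measure G s h g else run_measure G s g h) (parity G z) = 1"
    "parity_possible G z kap mu (s, m) \<longrightarrow>
      0 < measure (if y = 0 then run_measure G s h g else run_measure G s g h) (parity G z)"
proof -
  obtain kap mu M m where kap: "valid_memory G kap mu M" "m \<in> M"
    "\<And>s m. s \<in> player_states G y \<Longrightarrow> kap s m = \<phi> s" and conf_g: "conforms G kap mu m (1 - y) g"
    using finite_memory_play[OF y \<phi> g] by blast
  have conf_h: "conforms G kap mu m y h" by (rule total_extends_conforms[OF h kap(3)])
  have total_g: "total_strategy G (1 - y) g"
    using g unfolding finite_memory_strategies_def finite_memory_def by blast
  define v where "v = (s, m)"
  interpret play G n kap mu M "reachable kap mu v"
    by (intro play.intro play_axioms.intro arena_axioms kap markov_chain_reachable)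
  have v: "v \<in> reachable kap mu v" by (rule self_reachable)
  have run: "(if y = 0 then run_measure G s h g else run_measure G s g h) = state_measure v"
  proof (cases "y = 0")
    case True
    then show ?thesis
      using run_measure_eq[of s m h g] v conf_g conf_h total_g h(1) kap(2) unfolding v_def by simp
  next
    case False
    then have "y = 1" using y by simp
    then show ?thesis
      using run_measure_eq[of s m g h] v conf_g conf_h total_g h(1) kap(2) unfolding v_def by simp
  qed
  have hit: "AE \<omega> in T w. \<exists>i. \<omega> !! i \<in> A \<times> M" if "(v, w) \<in> (step_rel G kap mu)\<^sup>*" for w
    using attractor_AE_hit[OF att kap(1) _ chain, of w] valid_memory_reach[OF that kap(1)] that kap(2)
    unfolding reachable_def v_def by simp
  have finAM: "finite (A \<times> M)" using fin kap(1) unfolding valid_memory_def by simp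
  show thesis
  proof (rule that[OF kap(1,2)]; ((intro impI)?, (elim conjE)?))
    show "\<forall>s\<in>player_states G y. \<forall>m. kap s m = \<phi> s" using kap(3) by blast
  next
    assume no: "\<not> parity_possible G (1 - z) kap mu (s, m)" and z: "z \<le> 1"
    have "AE \<omega> in T v. stream_parity (node_colour G) z \<omega>"
    proof (rule AE_parity[OF v finAM])
      fix t assume "(v, t) \<in> (chain_rel (node_kernel G kap mu))\<^sup>*" "recurrent (chain_rel (node_kernel G kap mu)) t"
      then have t: "(v, t) \<in> (step_rel G kap mu)\<^sup>*" "recurrent (step_rel G kap mu) t"
        unfolding chain_rel_node_kernel .
      obtain c where c: "top_colour (step_rel G kap mu) (node_colour G) t c" using ex_top_colour by blast
      then have "c mod 2 \<noteq> (1 - z) mod 2" using no t unfolding parity_possible_def v_def by blast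
      then have "c mod 2 = z mod 2" using z by (cases z) auto
      then show "\<exists>c. top_colour (chain_rel (node_kernel G kap mu)) (node_colour G) t c \<and> c mod 2 = z mod 2"
        using c unfolding chain_rel_node_kernel by blast
    qed (use hit in \<open>simp add: chain_rel_node_kernel\<close>)
    then show "measure (if y = 0 then run_measure G s h g else run_measure G s g h) (parity G z) = 1"
      unfolding run by (rule measure_parity_eq_1[OF v])
  next
    assume "parity_possible G z kap mu (s, m)"
    then obtain t c where t: "(v, t) \<in> (step_rel G kap mu)\<^sup>*" "recurrent (step_rel G kap mu) t"
      "top_colour (step_rel G kap mu) (node_colour G) t c" "c mod 2 = z mod 2"
      unfolding parity_possible_def v_def by blast
    have "AE \<omega> in T t. stream_parity (node_colour G) z \<omega>"
    proof (rule AE_parity_recurrent[OF _ _ _ t(4) finAM])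
      show "t \<in> reachable kap mu v" using t(1) unfolding reachable_def by simp
      show "AE \<omega> in T w. \<exists>i. \<omega> !! i \<in> A \<times> M" if "(t, w) \<in> (chain_rel (node_kernel G kap mu))\<^sup>*" for w
        using that rtrancl_trans[OF t(1)] unfolding chain_rel_node_kernel by (intro hit) blast
    qed (use t in \<open>simp_all add: chain_rel_node_kernel\<close>)
    then have "\<not> (AE \<omega> in T v. \<not> stream_parity (node_colour G) z \<omega>)"
      using t(1) by (intro parity_positive[OF _ v]) (simp_all add: chain_rel_node_kernel)
    then show "0 < measure (if y = 0 then run_measure G s h g else run_measure G s g h) (parity G z)"
      unfolding run by (rule measure_parity_pos[OF v])
  qed
qed

theorem memoryless_determined:
  assumes x: "x \<le> 1"
  shows "\<exists>f g W W'. f \<in> memoryless_strategies G x \<and> g \<in> memoryless_strategies G (1 - x) \<and>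
     W \<union> W' = UNIV \<and> W \<inter> W' = {} \<and>
     W \<subseteq> winning_set G x f (finite_memory_strategies G (1 - x)) (parity G x) (\<lambda>r. r = 1) \<and>
     W' \<subseteq> winning_set G (1 - x) g (finite_memory_strategies G x) (parity G (1 - x)) (\<lambda>r. r > 0)"
proof -
  define z where "z = 1 - x"
  have z: "z \<le> 1" "1 - z = x" using x unfolding z_def by auto
  \<comment> \<open>\<open>V\<close> becomes the part \<open>W'\<close> of the partition and its
    complement becomes \<open>W\<close>.\<close>
  define V where "V = region G (parity_possible G z) z UNIV"
  have "subarena G UNIV" using game unfolding subarena_def is_game_def by blast
  moreover have "Col G s < Suc n" for s using game unfolding is_game_def by (simp add: less_Suc_eq_le)
  ultimately have "determined z UNIV" by (intro determined_subarena[OF z(1)])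
  then obtain f where f: "secures G (\<lambda>kap mu v. \<not> parity_possible G z kap mu v) x UNIV (UNIV - V) f"
    unfolding determined_def V_def z(2) by blast
  obtain g where g: "secures G (parity_possible G z) z UNIV V g"
    unfolding V_def using region_secures[OF eventual_parity_possible] by blast
  obtain \<phi> where \<phi>: "legal x \<phi>" "\<And>s. s \<in> UNIV - V \<Longrightarrow> s \<in> player_states G x \<Longrightarrow> (s, f s) \<in> E G \<Longrightarrow> \<phi> s = f s"
    using ex_legal[of x "UNIV - V" f] by blast
  obtain \<gamma> where \<gamma>: "legal z \<gamma>" "\<And>s. s \<in> V \<Longrightarrow> s \<in> player_states G z \<Longrightarrow> (s, g s) \<in> E G \<Longrightarrow> \<gamma> s = g s"
    using ex_legal[of z V g] by blast
  have "UNIV - V \<subseteq> winning_set G x (positional x \<phi>) (finite_memory_strategies G (1 - x)) (parity G x) (\<lambda>r. r = 1)"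
    unfolding winning_set_def
  proof (intro subsetI CollectI ballI allI impI, elim conjE)
    fix s g' h assume s: "s \<in> UNIV - V" and g': "g' \<in> finite_memory_strategies G (1 - x)"
      and h: "total_strategy G x h" "extends h (positional x \<phi>)"
    obtain kap mu M m where
      kap: "valid_memory G kap mu M" "m \<in> M" "\<forall>s\<in>player_states G x. \<forall>m. kap s m = \<phi> s"
      and res: "x \<le> 1 \<and> \<not> parity_possible G (1 - x) kap mu (s, m) \<longrightarrow>
        measure (if x = 0 then run_measure G s h g' else run_measure G s g' h) (parity G x) = 1"
        "parity_possible G x kap mu (s, m) \<longrightarrow>
        0 < measure (if x = 0 then run_measure G s h g' else run_measure G s g' h) (parity G x)"
      by (rule parity_probability[OF x \<phi>(1) g' h, where z = x and s = s]) (rule that; assumption)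
    have "follows G x UNIV (UNIV - V) f kap mu (s, m)"
      unfolding follows_def using kap(3) \<phi>(2) securesD(2)[OF f] by simp
    then have "\<not> parity_possible G z kap mu (s, m)"
      using securesD(4)[OF f kap(1)] kap(2) s by simp
    then show "measure (if x = 0 then run_measure G s h g' else run_measure G s g' h) (parity G x) = 1"
      using res(1) x unfolding z_def by blast
  qed
  moreover have "V \<subseteq> winning_set G (1 - x) (positional z \<gamma>) (finite_memory_strategies G x) (parity G (1 - x)) (\<lambda>r. r > 0)"
    unfolding winning_set_def z_def[symmetric]
  proof (intro subsetI CollectI ballI allI impI, elim conjE)
    fix s g' h assume s: "s \<in> V" and g': "g' \<in> finite_memory_strategies G x"
      and h: "total_strategy G z h" "extends h (positional z \<gamma>)"
    have g'z: "g' \<in> finite_memory_strategies G (1 - z)" using g' z(2) by simp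
    obtain kap mu M m where
      kap: "valid_memory G kap mu M" "m \<in> M" "\<forall>s\<in>player_states G z. \<forall>m. kap s m = \<gamma> s"
      and res: "z \<le> 1 \<and> \<not> parity_possible G (1 - z) kap mu (s, m) \<longrightarrow>
        measure (if z = 0 then run_measure G s h g' else run_measure G s g' h) (parity G z) = 1"
        "parity_possible G z kap mu (s, m) \<longrightarrow>
        0 < measure (if z = 0 then run_measure G s h g' else run_measure G s g' h) (parity G z)"
      by (rule parity_probability[OF z(1) \<gamma>(1) g'z h, where z = z and s = s]) (rule that; assumption)
    have "follows G z UNIV V g kap mu (s, m)"
      unfolding follows_def using kap(3) \<gamma>(2) securesD(2)[OF g] by simp
    then have "parity_possible G z kap mu (s, m)"
      using securesD(4)[OF g kap(1)] kap(2) s by simp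
    with res(2) show "0 < measure (if z = 0 then run_measure G s h g' else run_measure G s g' h) (parity G z)"
      by (rule mp)
  qed
  ultimately show ?thesis
    using memoryless_positional[OF \<phi>(1)] memoryless_positional[OF \<gamma>(1)] unfolding z_def
    by - (rule exI[of _ "positional x \<phi>"], rule exI[of _ "positional (1 - x) \<gamma>"],
      rule exI[of _ "UNIV - V"], rule exI[of _ V], simp add: Int_commute[of _ V])
qed

end

theorem mainTheorem1:
  fixes G :: "'s game" and n :: nat and x :: nat
  assumes "is_game G n"
    and "\<exists>A. finite A \<and> attractor G A"
    and "x \<le> 1"
  shows "\<exists>f g W W'. f \<in> memoryless_strategies G x \<and> g \<in> memoryless_strategies G (1 - x) \<and>
           W \<union> W' = UNIV \<and> W \<inter> W' = {} \<and>
           W \<subseteq> winning_set G x f (finite_memory_strategies G (1 - x)) (parity G x) (\<lambda>r. r = 1) \<and>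
           W' \<subseteq> winning_set G (1 - x) g (finite_memory_strategies G x) (parity G (1 - x)) (\<lambda>r. r > 0)"
proof -
  obtain A where "finite A" "attractor G A" using assms(2) by blast
  then interpret attracted_arena G n A
    by unfold_locales (use assms(1) in auto)
  show ?thesis by (rule memoryless_determined[OF assms(3)])
qed

end
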